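(* Let $f_1,\dots,f_n:\mathbb{R}^d\to\mathbb{R}$ be convex and differentiable, with $\nabla f_i$ being $L_i$-Lipschitz ($L_i>0$) in the Euclidean norm, let $R:\mathbb{R}^d\to\mathbb{R}$ be $\mu$-strongly convex with $\mu\ge 0$ ($\mu=0$ allowed), and suppose that $P=\frac1n\sum_{i=1}^n f_i+R$ has a minimizer $x_*$. Let $\widetilde x_0\in\mathbb{R}^d$, $\eta=4\bar L$ where $\bar L=\frac1n\sum_{i=1}^n L_i$, $m_1\in\mathbb{N}$ with $m_1\ge1$, and $0\le\alpha\le1$. Then the iterates $\widetilde x_s,\widetilde v_s$ of the SVRDA algorithm (defined in the context) run with these parameters satisfy, for every stage $s\ge1$, $$\mathbb{E}[P(\widetilde x_s)-P(x_* )]+\frac{\eta+m_s\mu}{2m_s}\,\mathbb{E}\|\widetilde v_s-x_*\|^2\le\frac12\,\mathbb{E}[P(\widetilde x_{s-1})-P(x_* )]+\Big(\frac{\alpha\eta}{2m_s}-\frac{\mu}{4}\Big)\mathbb{E}\|\widetilde x_{s-1}-x_*\|^2+\frac{(1-\alpha)\eta}{2m_s}\,\mathbb{E}\|\widetilde v_{s-1}-x_*\|^2 .$$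
   Context: All norms are Euclidean. $F=\frac1n\sum_{i=1}^n f_i$ and $P=F+R$. $R$ is $\mu$-strongly convex ($\mu\ge0$) means $R(y)\ge R(x)+\xi^\top(y-x)+\frac{\mu}{2}\|y-x\|^2$ for all $x,y\in\mathbb{R}^d$ and all $\xi\in\partial R(x)$. $Q$ is the probability distribution on $\{1,\dots,n\}$ with weights $q_i=L_i/(n\bar L)$. SVRDA algorithm with inputs $\widetilde x_0\in\mathbb{R}^d$, $\eta>0$, $m_1$, and $\alpha\in[0,1]$: set $\widetilde v_0=\widetilde x_0$. For stages $s=1,2,\dots$: put $x_0=\widetilde x_{s-1}$, $v_0=(1-\alpha)\widetilde v_{s-1}+\alpha\widetilde x_{s-1}$, $u_0=v_0$, $\bar g_0=0$, and $m_s=m_1$ if $\mu>0$, $m_s=2^{s-1}m_1$ if $\mu=0$. For $t=1,\dots,m_s$: draw $i_t$ from $Q$ independently of all earlier draws (in this and previous stages) and set $$g_t=\frac{\nabla f_{i_t}(u_{t-1})-\nabla f_{i_t}(x_0)}{nq_{i_t}}+\nabla F(x_0),\qquad \bar g_t=\Big(1-\frac1t\Big)\bar g_{t-1}+\frac1t g_t,$$ $$v_t=\operatorname*{argmin}_{x\in\mathbb{R}^d}\Big\{\langle\bar g_t,x\rangle+R(x)+\frac{\eta}{2t}\|x-v_0\|^2\Big\},\qquad x_t=\operatorname*{argmin}_{x\in\mathbb{R}^d}\Big\{\langle g_t,x\rangle+R(x)+\frac{\eta t}{2}\|x-u_{t-1}\|^2\Big\},$$ $$u_t=\Big(1-\frac1{t+1}\Big)x_t+\frac1{t+1}v_t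 .$$ Finally put $\widetilde x_s=x_{m_s}$ and $\widetilde v_s=v_{m_s}$. The expectation $\mathbb{E}$ is over all random draws. *)

theory Defs
  imports "HOL-Probability.Probability"
begin

definition grad :: "('a::real_inner \<Rightarrow> real) \<Rightarrow> 'a \<Rightarrow> 'a" where
  "grad f x = (THE D. GDERIV f x :> D)"

definition subdifferential :: "('a::real_inner \<Rightarrow> real) \<Rightarrow> 'a \<Rightarrow> 'a set" where
  "subdifferential R x = {\<xi>. \<forall>y. R y \<ge> R x + \<xi> \<bullet> (y - x)}"

text \<open>
  Convexity is stated separately: the subgradient inequality alone holds vacuously for a
  nonconvex function with empty subdifferentials.
\<close>
definition strongly_convex :: "real \<Rightarrow> ('a::real_inner \<Rightarrow> real) \<Rightarrow> bool" where
  "strongly_convex \<mu> R \<longleftrightarrow> convex_on UNIV R \<and>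
     (\<forall>x y. \<forall>\<xi>\<in>subdifferential R x.
        R y \<ge> R x + \<xi> \<bullet> (y - x) + \<mu> / 2 * (norm (y - x))\<^sup>2)"

definition finite_average :: "nat \<Rightarrow> (nat \<Rightarrow> 'a \<Rightarrow> real) \<Rightarrow> 'a \<Rightarrow> real" where
  "finite_average n f x = (\<Sum>i=1..n. f i x) / real n"

definition objective :: "nat \<Rightarrow> (nat \<Rightarrow> 'a \<Rightarrow> real) \<Rightarrow> ('a \<Rightarrow> real) \<Rightarrow> 'a \<Rightarrow> real" where
  "objective n f R x = finite_average n f x + R x"

definition Lbar :: "nat \<Rightarrow> (nat \<Rightarrow> real) \<Rightarrow> real" where
  "Lbar n L = (\<Sum>i=1..n. L i) / real n"

definition sampling_weight :: "nat \<Rightarrow> (nat \<Rightarrow> real) \<Rightarrow> nat \<Rightarrow> real" where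
  "sampling_weight n L i = L i / (real n * Lbar n L)"

definition stage_length :: "real \<Rightarrow> nat \<Rightarrow> nat \<Rightarrow> nat" where
  "stage_length \<mu> m1 s = (if \<mu> > 0 then m1 else 2 ^ (s - 1) * m1)"

definition svrda_gradient ::
    "nat \<Rightarrow> (nat \<Rightarrow> 'a::euclidean_space \<Rightarrow> real) \<Rightarrow> (nat \<Rightarrow> real) \<Rightarrow> 'a \<Rightarrow> 'a \<Rightarrow> nat \<Rightarrow> 'a" where
  "svrda_gradient n f L x0 u i =
     (1 / (real n * sampling_weight n L i)) *\<^sub>R (grad (f i) u - grad (f i) x0)
     + grad (finite_average n f) x0"

text \<open>
  The algorithm as a deterministic function of the drawn indices. Within a stage started from
  \<open>x0\<close> and \<open>v0\<close>, \<open>i t\<close> is the index drawn in step \<open>t \<ge> 1\<close>, and the state after \<open>t\<close> steps is the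
  tuple of the averaged gradient, \<open>x\<^sub>t\<close>, \<open>v\<^sub>t\<close> and \<open>u\<^sub>t\<close>.
\<close>
primrec svrda_inner ::
    "nat \<Rightarrow> (nat \<Rightarrow> 'a::euclidean_space \<Rightarrow> real) \<Rightarrow> (nat \<Rightarrow> real) \<Rightarrow> ('a \<Rightarrow> real) \<Rightarrow> real
      \<Rightarrow> 'a \<Rightarrow> 'a \<Rightarrow> (nat \<Rightarrow> nat) \<Rightarrow> nat \<Rightarrow> 'a \<times> 'a \<times> 'a \<times> 'a" where
  "svrda_inner n f L R \<eta> x0 v0 i 0 = (0, x0, v0, v0)"
| "svrda_inner n f L R \<eta> x0 v0 i (Suc k) =
     (let (gbar, x, v, u) = svrda_inner n f L R \<eta> x0 v0 i k;
          t = real (Suc k);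
          g = svrda_gradient n f L x0 u (i (Suc k));
          gbar' = (1 - 1 / t) *\<^sub>R gbar + (1 / t) *\<^sub>R g;
          v' = (ARG_MIN (\<lambda>y. gbar' \<bullet> y + R y + \<eta> / (2 * t) * (norm (y - v0))\<^sup>2) y. True);
          x' = (ARG_MIN (\<lambda>y. g \<bullet> y + R y + \<eta> * t / 2 * (norm (y - u))\<^sup>2) y. True);
          u' = (1 - 1 / (t + 1)) *\<^sub>R x' + (1 / (t + 1)) *\<^sub>R v'
      in (gbar', x', v', u'))"

text \<open>The pair \<open>(\<tilde>x\<^sub>s, \<tilde>v\<^sub>s)\<close>, where \<open>i s t\<close> is the index drawn in step \<open>t\<close> of stage \<open>s\<close>.\<close>
primrec svrda ::
    "nat \<Rightarrow> (nat \<Rightarrow> 'a::euclidean_space \<Rightarrow> real) \<Rightarrow> (nat \<Rightarrow> real) \<Rightarrow> ('a \<Rightarrow> real) \<Rightarrow> real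
      \<Rightarrow> real \<Rightarrow> real \<Rightarrow> nat \<Rightarrow> 'a \<Rightarrow> (nat \<Rightarrow> nat \<Rightarrow> nat) \<Rightarrow> nat \<Rightarrow> 'a \<times> 'a" where
  "svrda n f L R \<mu> \<eta> \<alpha> m1 xt0 i 0 = (xt0, xt0)"
| "svrda n f L R \<mu> \<eta> \<alpha> m1 xt0 i (Suc k) =
     (let (xt, vt) = svrda n f L R \<mu> \<eta> \<alpha> m1 xt0 i k;
          v0 = (1 - \<alpha>) *\<^sub>R vt + \<alpha> *\<^sub>R xt;
          (_, x, v, _) = svrda_inner n f L R \<eta> xt v0 (i (Suc k)) (stage_length \<mu> m1 (Suc k))
      in (x, v))"

text \<open>
  The iterates as random variables on the sample space carrying the draws; \<open>I s t \<omega>\<close> is the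
  index drawn in step \<open>t\<close> of stage \<open>s\<close>.
\<close>
definition svrda_x ::
    "nat \<Rightarrow> (nat \<Rightarrow> 'a::euclidean_space \<Rightarrow> real) \<Rightarrow> (nat \<Rightarrow> real) \<Rightarrow> ('a \<Rightarrow> real) \<Rightarrow> real
      \<Rightarrow> real \<Rightarrow> real \<Rightarrow> nat \<Rightarrow> 'a \<Rightarrow> (nat \<Rightarrow> nat \<Rightarrow> 'w \<Rightarrow> nat) \<Rightarrow> nat \<Rightarrow> 'w \<Rightarrow> 'a" where
  "svrda_x n f L R \<mu> \<eta> \<alpha> m1 xt0 I s \<omega> = fst (svrda n f L R \<mu> \<eta> \<alpha> m1 xt0 (\<lambda>s t. I s t \<omega>) s)"

definition svrda_v ::
    "nat \<Rightarrow> (nat \<Rightarrow> 'a::euclidean_space \<Rightarrow> real) \<Rightarrow> (nat \<Rightarrow> real) \<Rightarrow> ('a \<Rightarrow> real) \<Rightarrow> real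
      \<Rightarrow> real \<Rightarrow> real \<Rightarrow> nat \<Rightarrow> 'a \<Rightarrow> (nat \<Rightarrow> nat \<Rightarrow> 'w \<Rightarrow> nat) \<Rightarrow> nat \<Rightarrow> 'w \<Rightarrow> 'a" where
  "svrda_v n f L R \<mu> \<eta> \<alpha> m1 xt0 I s \<omega> = snd (svrda n f L R \<mu> \<eta> \<alpha> m1 xt0 (\<lambda>s t. I s t \<omega>) s)"

text \<open>
  The draws are mutually independent over all stages and steps, each with law \<open>Q\<close>. The weights
  on \<open>{1..n}\<close> sum to one, so they determine the law.
\<close>
definition svrda_draws ::
    "'w measure \<Rightarrow> nat \<Rightarrow> (nat \<Rightarrow> real) \<Rightarrow> (nat \<Rightarrow> nat) \<Rightarrow> (nat \<Rightarrow> nat \<Rightarrow> 'w \<Rightarrow> nat) \<Rightarrow> bool" where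
  "svrda_draws M n L m I \<longleftrightarrow>
     prob_space.indep_vars M (\<lambda>_. count_space UNIV) (\<lambda>(s, t). I s t) (SIGMA s:{1..}. {1..m s}) \<and>
     (\<forall>s\<ge>1. \<forall>t\<in>{1..m s}. \<forall>i\<in>{1..n}.
        measure M {\<omega> \<in> space M. I s t \<omega> = i} = sampling_weight n L i)"

end

theory Submission
  imports Defs
begin

text \<open>
  Write \<open>\<Lambda>\<close> for the mean smoothness constant, so \<open>\<eta> = 4 \<Lambda>\<close>, and consider one stage with starting
  points \<open>x0\<close>, \<open>v0\<close>. After \<open>k\<close> steps \<open>v\<^sub>k\<close> minimizes the dual model
  \<open>\<Gamma>\<^sub>k y = k (gbar\<^sub>k \<bullet> y) + k R y + \<eta> / 2 |y - v0|\<^sup>2\<close>, which grows around \<open>v\<^sub>k\<close> at least like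
  \<open>(\<eta> + k \<mu>) / 2 |y - v\<^sub>k|\<^sup>2\<close>. The proof follows the potential
  \<open>\<Phi>\<^sub>k = k (P x\<^sub>k - P xstar) + \<Gamma>\<^sub>k xstar - \<Gamma>\<^sub>k v\<^sub>k\<close>. Initially it is \<open>\<eta> / 2 |v0 - xstar|\<^sup>2\<close>, and by
  the growth of the dual model it always dominates
  \<open>k (P x\<^sub>k - P xstar) + (\<eta> + k \<mu>) / 2 |v\<^sub>k - xstar|\<^sup>2\<close>.

  In one step from \<open>u = u\<^sub>k\<close>, with gradient error \<open>\<delta> = g - grad F u\<close>, smoothness of \<open>F\<close>, the
  minimality of the proximal point and the growth of \<open>\<Gamma>\<^sub>k\<close> give for every outcome of the draw
  \<open>\<Phi>\<^sub>k\<^sub>+\<^sub>1 \<le> \<Phi>\<^sub>k + \<delta> \<bullet> z - D (xstar, u) + |\<delta>|\<^sup>2 / (6 \<Lambda>)\<close>, where \<open>D\<close> is the Bregman divergence of \<open>F\<close>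
  and \<open>z\<close> does not depend on the draw (\<open>potential_step_pathwise\<close>). The error \<open>\<delta>\<close> has mean zero, and
  comparing both gradients in it with those at \<open>xstar\<close> bounds its second moment by
  \<open>6 \<Lambda> D (xstar, u) + 3 \<Lambda> D (x0, xstar)\<close> (\<open>grad_error_second_moment\<close>). In expectation the divergence
  at \<open>u\<close> therefore cancels, and the potential increases by at most \<open>D (x0, xstar) / 2\<close> per step. Since
  \<open>xstar\<close> is a minimizer and \<open>R\<close> is strongly convex,
  \<open>D (x0, xstar) \<le> P x0 - P xstar - \<mu> / 2 |x0 - xstar|\<^sup>2\<close>; this produces the factor \<open>1 / 2\<close> and the
  term \<open>- \<mu> / 4\<close> of the recursion. Summing over the stage, bounding \<open>|v0 - xstar|\<^sup>2\<close> by convexity in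
  the two points that \<open>v0\<close> mixes, and dividing by the stage length gives the claim.

  The iterates are functions of finitely many draws, each almost surely in the finite set \<open>{1..n}\<close>.
  Expectations are therefore finite sums over paths of draws, conditioning on the past is summation
  over the last coordinate of the path (\<open>path_mean_insert\<close>), and independence enters only when the
  probability of a path is computed (\<open>has_bochner_integral_path_mean\<close>).
\<close>

section \<open>Gradients and minimizers\<close>

lemma GDERIV_unique_gradient:
  assumes "GDERIV f x :> D" "GDERIV f x :> D'"
  shows "D = D'"
proof -
  have "(\<lambda>h. h \<bullet> D) = (\<lambda>h. h \<bullet> D')"
    using assms has_derivative_unique unfolding gderiv_def by blast
  then show ?thesis
    by (metis vector_eq_ldot)
qed

lemma grad_eqI: "GDERIV f x :> D \<Longrightarrow> grad f x = D"
  unfolding grad_def using GDERIV_unique_gradient by blast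

lemma GDERIV_grad:
  fixes f :: "'a::euclidean_space \<Rightarrow> real"
  assumes "f differentiable (at x)"
  shows "GDERIV f x :> grad f x"
proof -
  obtain f' where f': "(f has_derivative f') (at x)"
    using assms by (auto simp: differentiable_def)
  interpret f': bounded_linear f'
    using f' by (rule has_derivative_bounded_linear)
  have "f' = (\<lambda>h. h \<bullet> (\<Sum>b\<in>Basis. f' b *\<^sub>R b))"
  proof
    fix h
    have "f' h = f' (\<Sum>b\<in>Basis. (h \<bullet> b) *\<^sub>R b)"
      by (simp add: euclidean_representation)
    also have "\<dots> = h \<bullet> (\<Sum>b\<in>Basis. f' b *\<^sub>R b)"
      by (simp add: f'.sum f'.scaleR inner_sum_right mult.commute)
    finally show "f' h = h \<bullet> (\<Sum>b\<in>Basis. f' b *\<^sub>R b)" .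
  qed
  then have "GDERIV f x :> (\<Sum>b\<in>Basis. f' b *\<^sub>R b)"
    using f' by (simp add: gderiv_def)
  then show ?thesis
    using grad_eqI by metis
qed

lemma has_real_derivative_along_line:
  assumes "GDERIV f (x + t *\<^sub>R d) :> D"
  shows "((\<lambda>t. f (x + t *\<^sub>R d)) has_real_derivative d \<bullet> D) (at t)"
proof -
  have "((\<lambda>t. x + t *\<^sub>R d) has_derivative (\<lambda>h. h *\<^sub>R d)) (at t)"
    by (auto intro!: derivative_eq_intros)
  from has_derivative_compose[OF this assms[unfolded gderiv_def]]
  show ?thesis
    by (simp add: has_field_derivative_def mult.commute[of _ "d \<bullet> D"])
qed

text \<open>
  Moving from a minimizer \<open>z\<close> towards \<open>y\<close>, the convex part gains at most linearly,
  \<open>R (z + t (y - z)) \<le> R z + t (R y - R z)\<close>, so the slope of the smooth part at \<open>t = 0\<close> must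
  be at least \<open>R z - R y\<close>.
  This optimality condition supplies every subgradient used below: at the minimizer of the
  objective, at the dual averaging point, and, applied to \<open>- f + f\<close>, at an arbitrary point of
  a differentiable convex function.
\<close>
lemma minimizer_subgradient:
  fixes R G :: "'a::real_inner \<Rightarrow> real"
  assumes R: "convex_on UNIV R" and G: "GDERIV G z :> D"
    and min: "\<And>y. G z + R z \<le> G y + R y"
  shows "- D \<in> subdifferential R z"
  unfolding subdifferential_def
proof (intro CollectI allI)
  fix y
  let ?\<phi> = "\<lambda>t. G (z + t *\<^sub>R (y - z))"
  have "(?\<phi> has_real_derivative (y - z) \<bullet> D) (at 0)"
    using G by (intro has_real_derivative_along_line) simp
  then have "((\<lambda>t. (?\<phi> t - G z) / t) \<longlongrightarrow> (y - z) \<bullet> D) (at 0)"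
    by (simp add: DERIV_def)
  then have lim: "((\<lambda>t. (?\<phi> t - G z) / t) \<longlongrightarrow> (y - z) \<bullet> D) (at_right 0)"
    by (rule filterlim_mono) (auto simp: at_le)
  have "eventually (\<lambda>t. t \<in> {0<..<1}) (at_right (0::real))"
    by (rule eventually_at_right_real) simp
  then have "eventually (\<lambda>t. R z - R y \<le> (?\<phi> t - G z) / t) (at_right 0)"
  proof eventually_elim
    case (elim t)
    have eq: "z + t *\<^sub>R (y - z) = (1 - t) *\<^sub>R z + t *\<^sub>R y"
      by (simp add: algebra_simps)
    have "R (z + t *\<^sub>R (y - z)) \<le> (1 - t) * R z + t * R y"
      unfolding eq using elim by (intro convex_onD[OF R]) auto
    then have "t * (R z - R y) \<le> ?\<phi> t - G z"
      using min[of "z + t *\<^sub>R (y - z)"] by (simp add: algebra_simps)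
    then show ?case
      using elim by (simp add: pos_le_divide_eq mult.commute)
  qed
  then have "R z - R y \<le> (y - z) \<bullet> D"
    by (intro tendsto_lowerbound[OF lim]) simp_all
  then show "R y \<ge> R z + (- D) \<bullet> (y - z)"
    by (simp add: inner_commute)
qed

lemma grad_in_subdifferential:
  assumes "convex_on UNIV f" "GDERIV f x :> D"
  shows "D \<in> subdifferential f x"
  using minimizer_subgradient[of f "\<lambda>x. - f x" x "- D"] assms by (simp add: GDERIV_minus)

lemma GDERIV_linear_quadratic:
  fixes g v :: "'a::real_inner"
  shows "GDERIV (\<lambda>y. g \<bullet> y + c / 2 * (norm (y - v))\<^sup>2) z :> g + c *\<^sub>R (z - v)"
  unfolding gderiv_def power2_norm_eq_inner
  by (auto intro!: derivative_eq_intros simp: algebra_simps inner_commute inner_add_right inner_diff_right)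

text \<open>
  The affine minorant given by one subgradient is beaten by the quadratic term outside a large
  ball, and inside the ball a minimizer exists by compactness.
\<close>
lemma proximal_minimizer_exists:
  fixes R :: "'a::euclidean_space \<Rightarrow> real"
  assumes R: "convex_on UNIV R" and \<xi>: "\<xi> \<in> subdifferential R a" and c: "c > 0"
  shows "\<exists>z. \<forall>y. g \<bullet> z + R z + c / 2 * (norm (z - v))\<^sup>2
               \<le> g \<bullet> y + R y + c / 2 * (norm (y - v))\<^sup>2"
proof -
  define h where "h y = g \<bullet> y + R y + c / 2 * (norm (y - v))\<^sup>2" for y
  define w where "w = \<xi> + g"
  define \<Delta> where "\<Delta> = R v - (R a + \<xi> \<bullet> (v - a))"
  define \<rho> where "\<rho> = 2 * (norm w + \<Delta>) / c + 1"
  have "\<Delta> \<ge> 0"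
    using \<xi> by (auto simp: \<Delta>_def subdifferential_def)
  then have \<rho>: "\<rho> \<ge> 1"
    using c by (simp add: \<rho>_def)
  have far: "h v \<le> h y" if "norm (y - v) \<ge> \<rho>" for y
  proof -
    define r where "r = norm (y - v)"
    have r: "r \<ge> \<rho>" "r \<ge> 1"
      using that \<rho> by (auto simp: r_def)
    have "c * \<rho> = 2 * (norm w + \<Delta>) + c"
      using c by (simp add: \<rho>_def field_simps)
    then have "2 * (norm w + \<Delta>) \<le> c * r"
      using r c mult_left_mono[of \<rho> r c] by linarith
    then have "\<Delta> \<le> c / 2 * r - norm w"
      by (simp add: field_simps)
    also have "\<dots> \<le> r * (c / 2 * r - norm w)"
      using \<open>\<Delta> \<ge> 0\<close> calculation r mult_right_mono[of 1 r "c / 2 * r - norm w"] by simp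
    finally have \<Delta>: "\<Delta> \<le> c / 2 * r\<^sup>2 - norm w * r"
      by (simp add: algebra_simps power2_eq_square)
    have "- (norm w * r) \<le> w \<bullet> (y - v)"
      using Cauchy_Schwarz_ineq2[of w "y - v"] by (simp add: r_def abs_le_iff)
    moreover have "R a + \<xi> \<bullet> (y - a) \<le> R y"
      using \<xi> by (simp add: subdifferential_def)
    ultimately show ?thesis
      using \<Delta> unfolding h_def \<Delta>_def w_def r_def
      by (simp add: inner_diff_right inner_add_left)
  qed
  have "continuous_on (cball v \<rho>) R"
    using convex_on_continuous[OF open_UNIV R] by (rule continuous_on_subset) simp
  then have "continuous_on (cball v \<rho>) h"
    unfolding h_def by (intro continuous_intros)
  moreover have v: "v \<in> cball v \<rho>"
    using \<rho> by simp
  ultimately have "\<exists>z\<in>cball v \<rho>. \<forall>y\<in>cball v \<rho>. h z \<le> h y"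
    by (intro continuous_attains_inf compact_cball) auto
  then obtain z where z: "z \<in> cball v \<rho>" "\<And>y. y \<in> cball v \<rho> \<Longrightarrow> h z \<le> h y"
    by blast
  have "h z \<le> h y" for y
  proof (cases "y \<in> cball v \<rho>")
    case False
    then have "h v \<le> h y"
      by (intro far) (simp add: dist_norm norm_minus_commute)
    then show ?thesis
      using z(2)[OF v] by linarith
  qed (use z in auto)
  then show ?thesis
    unfolding h_def by blast
qed

lemma ARG_MIN_le:
  fixes h :: "'a \<Rightarrow> 'b::linorder"
  assumes "\<exists>z. \<forall>y. h z \<le> h y"
  shows "h (ARG_MIN h y. True) \<le> h y"
proof -
  have "is_arg_min h (\<lambda>_. True) (ARG_MIN h y. True)"
    unfolding arg_min_def by (rule someI_ex) (use assms in \<open>simp add: is_arg_min_linorder\<close>)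
  then show ?thesis
    by (simp add: is_arg_min_linorder)
qed

section \<open>Smooth convex functions\<close>

definition bregman :: "('a::real_inner \<Rightarrow> real) \<Rightarrow> 'a \<Rightarrow> 'a \<Rightarrow> real" where
  "bregman f y x = f y - f x - grad f x \<bullet> (y - x)"

lemma bregman_nonneg:
  fixes f :: "'a::euclidean_space \<Rightarrow> real"
  assumes "convex_on UNIV f" "f differentiable (at x)"
  shows "bregman f y x \<ge> 0"
  using grad_in_subdifferential[OF assms(1) GDERIV_grad[OF assms(2)]]
  by (simp add: subdifferential_def bregman_def algebra_simps)

text \<open>
  Along the segment from \<open>x\<close> to \<open>y\<close> the function minus its claimed upper bound has derivative
  \<open>(grad f (x + t d) - grad f x) \<bullet> d - t L |d|\<^sup>2\<close>, which is nonpositive by Cauchy--Schwarz.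
\<close>
lemma bregman_le_quadratic:
  fixes f :: "'a::euclidean_space \<Rightarrow> real"
  assumes diff: "\<And>x. f differentiable (at x)" and lip: "L-lipschitz_on UNIV (grad f)"
  shows "bregman f y x \<le> L / 2 * (norm (y - x))\<^sup>2"
proof -
  define d where "d = y - x"
  define \<phi> where "\<phi> t = f (x + t *\<^sub>R d) - t * (grad f x \<bullet> d) - L / 2 * t\<^sup>2 * (norm d)\<^sup>2" for t
  have "\<phi> 1 \<le> \<phi> 0"
  proof (rule DERIV_nonpos_imp_nonincreasing[of 0 1 \<phi>])
    fix t :: real assume t: "0 \<le> t" "t \<le> 1"
    let ?D = "d \<bullet> grad f (x + t *\<^sub>R d) - grad f x \<bullet> d - L * t * (norm d)\<^sup>2"
    have "(\<phi> has_real_derivative ?D) (at t)"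
      unfolding \<phi>_def
      by (rule derivative_eq_intros has_real_derivative_along_line GDERIV_grad diff refl)+ simp
    moreover have "?D \<le> 0"
    proof -
      have "d \<bullet> grad f (x + t *\<^sub>R d) - grad f x \<bullet> d = (grad f (x + t *\<^sub>R d) - grad f x) \<bullet> d"
        by (simp add: inner_diff_right inner_commute[of _ d])
      also have "\<dots> \<le> norm (grad f (x + t *\<^sub>R d) - grad f x) * norm d"
        by (rule norm_cauchy_schwarz)
      also have "\<dots> \<le> (L * norm (t *\<^sub>R d)) * norm d"
        using lipschitz_onD[OF lip, of "x + t *\<^sub>R d" x]
        by (intro mult_right_mono) (auto simp: dist_norm)
      also have "\<dots> = L * t * (norm d)\<^sup>2"
        using t by (simp add: power2_eq_square)
      finally show ?thesis by simp
    qed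
    ultimately show "\<exists>y. (\<phi> has_real_derivative y) (at t) \<and> y \<le> 0"
      by blast
  qed simp
  then show ?thesis
    by (simp add: \<phi>_def d_def bregman_def)
qed

text \<open>
  The function \<open>w \<mapsto> f w - grad f x \<bullet> w\<close> is convex with vanishing gradient at \<open>x\<close>, hence minimal
  there; its value at \<open>x\<close> is compared with the value after one gradient step of length
  \<open>1 / L\<close> from \<open>y\<close>.
\<close>
lemma norm_grad_diff_le_bregman:
  fixes f :: "'a::euclidean_space \<Rightarrow> real"
  assumes cvx: "convex_on UNIV f" and diff: "\<And>x. f differentiable (at x)"
    and lip: "L-lipschitz_on UNIV (grad f)" and L: "L > 0"
  shows "(norm (grad f y - grad f x))\<^sup>2 \<le> 2 * L * bregman f y x"
proof -
  define d where "d = grad f y - grad f x"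
  define w where "w = y - (1 / L) *\<^sub>R d"
  have "0 \<le> bregman f w x"
    by (rule bregman_nonneg[OF cvx diff])
  moreover have "bregman f w y \<le> L / 2 * (norm (w - y))\<^sup>2"
    by (rule bregman_le_quadratic[OF diff lip])
  moreover have "L / 2 * (norm (w - y))\<^sup>2 = (norm d)\<^sup>2 / (2 * L)"
    using L by (simp add: w_def power_divide power2_eq_square)
  moreover have "bregman f w x = bregman f w y + bregman f y x - (norm d)\<^sup>2 / L"
  proof -
    have "(norm d)\<^sup>2 / L = d \<bullet> (y - w)"
      by (simp add: w_def power2_norm_eq_inner)
    then show ?thesis
      by (simp add: d_def bregman_def algebra_simps inner_diff_left inner_diff_right)
  qed
  moreover have "(norm d)\<^sup>2 / L = 2 * ((norm d)\<^sup>2 / (2 * L))"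
    by simp
  ultimately have "(norm d)\<^sup>2 / (2 * L) \<le> bregman f y x"
    by linarith
  then show ?thesis
    using L by (simp add: d_def field_simps)
qed

text \<open>
  The asymmetric weights matter: \<open>a\<close> will be the gradient difference between \<open>u\<close> and \<open>xstar\<close>, and
  with the coefficient \<open>3\<close> its contribution is exactly cancelled in the descent of the potential,
  which leaves the coefficient \<open>3 / 2\<close> for the contribution of the reference point.
\<close>
lemma norm_diff_power2_le:
  fixes a b :: "'a::real_inner"
  shows "(norm (a - b))\<^sup>2 \<le> 3 * (norm a)\<^sup>2 + 3 / 2 * (norm b)\<^sup>2"
proof -
  have "0 \<le> (norm (2 *\<^sub>R a + b))\<^sup>2" by simp
  then show ?thesis
    by (simp only: power2_norm_eq_inner)
       (simp add: inner_add_left inner_add_right inner_diff_left inner_diff_right inner_commute)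
qed

section \<open>The variance-reduced gradient\<close>

text \<open>Centring can only decrease a second moment.\<close>
lemma weighted_variance_le_second_moment:
  fixes a :: "'i \<Rightarrow> 'a::real_inner"
  assumes "sum q A = 1" and b: "(\<Sum>j\<in>A. q j *\<^sub>R a j) = b"
  shows "(\<Sum>j\<in>A. q j * (norm (a j - b))\<^sup>2) \<le> (\<Sum>j\<in>A. q j * (norm (a j))\<^sup>2)"
proof -
  have "(\<Sum>j\<in>A. q j * (norm (a j - b))\<^sup>2)
      = (\<Sum>j\<in>A. q j * (norm (a j))\<^sup>2 - 2 * ((q j *\<^sub>R a j) \<bullet> b) + q j * (norm b)\<^sup>2)"
    by (intro sum.cong refl)
       (simp add: power2_norm_eq_inner inner_diff_left inner_diff_right inner_commute algebra_simps)
  also have "\<dots> = (\<Sum>j\<in>A. q j * (norm (a j))\<^sup>2) - 2 * ((\<Sum>j\<in>A. q j *\<^sub>R a j) \<bullet> b)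
                  + sum q A * (norm b)\<^sup>2"
    by (simp add: sum.distrib sum_subtractf sum_distrib_left sum_distrib_right inner_sum_left)
  also have "\<dots> = (\<Sum>j\<in>A. q j * (norm (a j))\<^sup>2) - (norm b)\<^sup>2"
    by (simp add: b assms(1) power2_norm_eq_inner)
  finally show ?thesis by simp
qed

lemma svrda_inner_Suc_eqs:
  assumes "svrda_inner n f L R \<eta> x0 v0 i k = (gbar, x, v, u)"
    and "svrda_inner n f L R \<eta> x0 v0 i (Suc k) = (gbar', x', v', u')"
  defines "t \<equiv> real (Suc k)" and "g \<equiv> svrda_gradient n f L x0 u (i (Suc k))"
  shows "gbar' = (1 - 1 / t) *\<^sub>R gbar + (1 / t) *\<^sub>R g"
    and "v' = (ARG_MIN (\<lambda>y. gbar' \<bullet> y + R y + \<eta> / (2 * t) * (norm (y - v0))\<^sup>2) y. True)"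
    and "x' = (ARG_MIN (\<lambda>y. g \<bullet> y + R y + \<eta> * t / 2 * (norm (y - u))\<^sup>2) y. True)"
    and "u' = (1 - 1 / (t + 1)) *\<^sub>R x' + (1 / (t + 1)) *\<^sub>R v'"
  using assms(2) unfolding svrda_inner.simps assms(1) Let_def prod.case prod.inject t_def g_def
  by blast+

lemma svrda_inner_cong:
  assumes "\<And>t. t \<in> {1..k} \<Longrightarrow> i t = i' t"
  shows "svrda_inner n f L R \<eta> x0 v0 i k = svrda_inner n f L R \<eta> x0 v0 i' k"
  using assms by (induction k) auto

locale composite_problem =
  fixes n :: nat and f :: "nat \<Rightarrow> 'a::euclidean_space \<Rightarrow> real" and L :: "nat \<Rightarrow> real"
    and R :: "'a \<Rightarrow> real" and \<mu> :: real and xstar :: 'a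
  assumes n_ge_1: "n \<ge> 1"
    and f_convex: "i \<in> {1..n} \<Longrightarrow> convex_on UNIV (f i)"
    and f_differentiable: "i \<in> {1..n} \<Longrightarrow> f i differentiable (at x)"
    and L_pos: "i \<in> {1..n} \<Longrightarrow> L i > 0"
    and f_lipschitz: "i \<in> {1..n} \<Longrightarrow> (L i)-lipschitz_on UNIV (grad (f i))"
    and mu_nonneg: "\<mu> \<ge> 0"
    and R_strongly_convex: "strongly_convex \<mu> R"
    and xstar_minimizer: "is_arg_min (objective n f R) (\<lambda>_. True) xstar"
begin

abbreviation "F \<equiv> finite_average n f"
abbreviation "P \<equiv> objective n f R"
abbreviation "\<Lambda> \<equiv> Lbar n L"
abbreviation "q \<equiv> sampling_weight n L"

lemma n_pos: "real n > 0"
  using n_ge_1 by simp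

lemma sum_L: "(\<Sum>i=1..n. L i) = real n * \<Lambda>"
  using n_pos by (simp add: Lbar_def)

lemma Lbar_pos: "\<Lambda> > 0"
  unfolding Lbar_def using n_pos by (intro divide_pos_pos sum_pos) (auto intro: L_pos)

lemma q_pos: "i \<in> {1..n} \<Longrightarrow> q i > 0"
  unfolding sampling_weight_def using n_pos Lbar_pos L_pos by simp

lemma sum_q: "(\<Sum>i=1..n. q i) = 1"
  unfolding sampling_weight_def sum_divide_distrib[symmetric] sum_L
  using n_pos Lbar_pos by simp

lemma R_convex: "convex_on UNIV R"
  using R_strongly_convex by (simp add: strongly_convex_def)

lemma R_strong_subgradient:
  "\<xi> \<in> subdifferential R x \<Longrightarrow> R x + \<xi> \<bullet> (y - x) + \<mu> / 2 * (norm (y - x))\<^sup>2 \<le> R y"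
  using R_strongly_convex by (simp add: strongly_convex_def)

lemma GDERIV_F: "GDERIV F x :> (1 / real n) *\<^sub>R (\<Sum>i=1..n. grad (f i) x)"
proof -
  have "((\<lambda>x. \<Sum>i=1..n. f i x) has_derivative (\<lambda>h. \<Sum>i=1..n. h \<bullet> grad (f i) x)) (at x)"
    using GDERIV_grad[OF f_differentiable] by (intro has_derivative_sum) (simp add: gderiv_def)
  from has_derivative_mult_right[OF this, of "1 / real n"]
  show ?thesis
    by (simp add: gderiv_def finite_average_def[abs_def] inner_sum_right)
qed

lemma grad_F: "grad F x = (1 / real n) *\<^sub>R (\<Sum>i=1..n. grad (f i) x)"
  using GDERIV_F by (rule grad_eqI)

lemma F_differentiable: "F differentiable (at x)"
  using GDERIV_F unfolding gderiv_def differentiable_def by blast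

lemma bregman_F: "bregman F y x = (\<Sum>i=1..n. bregman (f i) y x) / real n"
  by (simp add: bregman_def grad_F finite_average_def inner_sum_left sum_subtractf diff_divide_distrib)

lemma bregman_F_nonneg: "bregman F y x \<ge> 0"
  unfolding bregman_F
  by (intro divide_nonneg_nonneg sum_nonneg bregman_nonneg f_convex f_differentiable) auto

lemma bregman_F_le_quadratic: "bregman F y x \<le> \<Lambda> / 2 * (norm (y - x))\<^sup>2"
proof -
  have "(\<Sum>i=1..n. bregman (f i) y x) \<le> (\<Sum>i=1..n. L i / 2 * (norm (y - x))\<^sup>2)"
    by (intro sum_mono bregman_le_quadratic f_differentiable f_lipschitz)
  also have "\<dots> = real n * (\<Lambda> / 2 * (norm (y - x))\<^sup>2)"
    by (simp add: sum_distrib_right[symmetric] sum_divide_distrib[symmetric] sum_L del: One_nat_def)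
  finally show ?thesis
    unfolding bregman_F using n_pos by (simp add: divide_le_eq mult.commute)
qed

lemma neg_grad_F_subgradient: "- grad F xstar \<in> subdifferential R xstar"
proof (rule minimizer_subgradient[OF R_convex])
  show "GDERIV F xstar :> grad F xstar"
    by (rule GDERIV_grad[OF F_differentiable])
  show "F xstar + R xstar \<le> F y + R y" for y
    using xstar_minimizer by (simp add: is_arg_min_linorder objective_def)
qed

lemma bregman_le_objective_gap:
  "bregman F x xstar + \<mu> / 2 * (norm (x - xstar))\<^sup>2 \<le> P x - P xstar"
  using R_strong_subgradient[OF neg_grad_F_subgradient, of x]
  by (simp add: bregman_def objective_def)

abbreviation "grad_error x0 u j \<equiv> svrda_gradient n f L x0 u j - grad F u"

lemma grad_error_eq:
  "grad_error x0 u j = (1 / (real n * q j)) *\<^sub>R (grad (f j) u - grad (f j) x0)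
                       - (grad F u - grad F x0)"
  by (simp add: svrda_gradient_def)

lemma importance_weighted_mean:
  "(\<Sum>j=1..n. q j *\<^sub>R ((1 / (real n * q j)) *\<^sub>R (grad (f j) u - grad (f j) x0)))
     = grad F u - grad F x0"
proof -
  have "(\<Sum>j=1..n. q j *\<^sub>R ((1 / (real n * q j)) *\<^sub>R (grad (f j) u - grad (f j) x0)))
      = (\<Sum>j=1..n. (1 / real n) *\<^sub>R (grad (f j) u - grad (f j) x0))"
  proof (intro sum.cong refl)
    fix j assume "j \<in> {1..n}"
    then show "q j *\<^sub>R ((1 / (real n * q j)) *\<^sub>R (grad (f j) u - grad (f j) x0))
             = (1 / real n) *\<^sub>R (grad (f j) u - grad (f j) x0)"
      using q_pos[of j] by simp
  qed
  also have "\<dots> = grad F u - grad F x0"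
    by (simp add: grad_F scaleR_sum_right[symmetric] sum_subtractf scaleR_diff_right)
  finally show ?thesis .
qed

lemma grad_error_mean: "(\<Sum>j=1..n. q j *\<^sub>R grad_error x0 u j) = 0"
proof -
  have "(\<Sum>j=1..n. q j *\<^sub>R (a j - b)) = (\<Sum>j=1..n. q j *\<^sub>R a j) - (\<Sum>j=1..n. q j) *\<^sub>R b"
    for a and b :: 'a
    by (simp add: scaleR_diff_right sum_subtractf scaleR_sum_left)
  then show ?thesis
    by (simp only: grad_error_eq importance_weighted_mean sum_q) simp
qed

text \<open>
  Both \<open>grad f\<^sub>j u\<close> and \<open>grad f\<^sub>j x0\<close> are compared with \<open>grad f\<^sub>j xstar\<close>. The distances are bounded
  by Bregman divergences, and sampling proportionally to \<open>L j\<close> cancels the individual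
  smoothness constants. The divergence at \<open>u\<close> is taken in the direction in which it appears, with
  the opposite sign, in the descent of the potential.
\<close>
lemma grad_error_second_moment:
  "(\<Sum>j=1..n. q j * (norm (grad_error x0 u j))\<^sup>2)
     \<le> 6 * \<Lambda> * bregman F xstar u + 3 * \<Lambda> * bregman F x0 xstar"
proof -
  let ?d = "\<lambda>j. grad (f j) u - grad (f j) x0"
  have "(\<Sum>j=1..n. q j * (norm (grad_error x0 u j))\<^sup>2)
      \<le> (\<Sum>j=1..n. q j * (norm ((1 / (real n * q j)) *\<^sub>R ?d j))\<^sup>2)"
    unfolding grad_error_eq
    by (rule weighted_variance_le_second_moment[OF sum_q importance_weighted_mean])
  also have "\<dots> \<le> (\<Sum>j=1..n. \<Lambda> / real n * (6 * bregman (f j) xstar u + 3 * bregman (f j) x0 xstar))"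
  proof (rule sum_mono)
    fix j assume j: "j \<in> {1..n}"
    have "(norm (?d j))\<^sup>2
        = (norm ((grad (f j) u - grad (f j) xstar) - (grad (f j) x0 - grad (f j) xstar)))\<^sup>2"
      by simp
    also have "\<dots> \<le> 3 * (norm (grad (f j) u - grad (f j) xstar))\<^sup>2
                    + 3 / 2 * (norm (grad (f j) x0 - grad (f j) xstar))\<^sup>2"
      by (rule norm_diff_power2_le)
    also have "\<dots> \<le> 3 * (2 * L j * bregman (f j) xstar u)
                    + 3 / 2 * (2 * L j * bregman (f j) x0 xstar)"
      unfolding norm_minus_commute[of "grad (f j) u"]
      using j by (intro add_mono mult_left_mono norm_grad_diff_le_bregman
          f_convex f_differentiable f_lipschitz L_pos) auto
    also have "\<dots> = L j * (6 * bregman (f j) xstar u + 3 * bregman (f j) x0 xstar)"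
      by (simp add: algebra_simps)
    finally have d: "(norm (?d j))\<^sup>2 \<le> \<dots>" .
    have "q j * (norm ((1 / (real n * q j)) *\<^sub>R ?d j))\<^sup>2 = \<Lambda> / (real n * L j) * (norm (?d j))\<^sup>2"
    proof -
      have "q j * (1 / (real n * q j))\<^sup>2 = \<Lambda> / (real n * L j)"
        using L_pos[OF j] Lbar_pos n_pos
        by (simp add: sampling_weight_def power2_eq_square)
      moreover have "q j * (norm (c *\<^sub>R ?d j))\<^sup>2 = q j * c\<^sup>2 * (norm (?d j))\<^sup>2" for c
        by (simp add: power_mult_distrib)
      ultimately show ?thesis
        by (simp only:)
    qed
    also have "\<dots> \<le> \<Lambda> / (real n * L j) *
                    (L j * (6 * bregman (f j) xstar u + 3 * bregman (f j) x0 xstar))"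
      using d L_pos[OF j] Lbar_pos by (intro mult_left_mono) auto
    also have "\<dots> = \<Lambda> / real n * (6 * bregman (f j) xstar u + 3 * bregman (f j) x0 xstar)"
      using L_pos[OF j] by simp
    finally show "q j * (norm ((1 / (real n * q j)) *\<^sub>R ?d j))\<^sup>2 \<le> \<dots>" .
  qed
  also have "\<dots> = 6 * \<Lambda> * bregman F xstar u + 3 * \<Lambda> * bregman F x0 xstar"
    unfolding bregman_F sum_distrib_left[symmetric] sum.distrib
    by (simp add: add_divide_distrib distrib_left mult.assoc mult.left_commute)
  finally show ?thesis .
qed

section \<open>The potential within a stage\<close>


abbreviation "\<eta> \<equiv> 4 * \<Lambda>"

text \<open>
  For \<open>k \<ge> 1\<close> this is \<open>k\<close> times the function that \<open>v\<^sub>k\<close> minimizes. At \<open>k = 0\<close> it is \<open>\<eta> / 2 |y - v0|\<^sup>2\<close>, whose minimizer is the initial value \<open>v0\<close>.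
\<close>
definition dual_model :: "'a \<Rightarrow> nat \<Rightarrow> 'a \<Rightarrow> 'a \<Rightarrow> real" where
  "dual_model v0 k gbar y = real k * (gbar \<bullet> y) + real k * R y + \<eta> / 2 * (norm (y - v0))\<^sup>2"

text \<open>
  Only a difference of values of the dual model enters, so the constants \<open>F u - g \<bullet> u\<close> that would
  turn the model into a sum of linearizations of the objective drop out, and the potential depends on
  the current state alone.
\<close>
fun potential :: "'a \<Rightarrow> nat \<Rightarrow> 'a \<times> 'a \<times> 'a \<times> 'a \<Rightarrow> real" where
  "potential v0 k (gbar, x, v, u)
     = real k * (P x - P xstar) + (dual_model v0 k gbar xstar - dual_model v0 k gbar v)"

text \<open>
  These two properties are all that a step needs to know about the current state. At \<open>k = 0\<close> they
  hold because \<open>u\<close> and \<open>v\<close> both start at \<open>v0\<close>, so the first step is not a special case although no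
  minimization has taken place yet.
\<close>
fun coupled_state :: "'a \<Rightarrow> nat \<Rightarrow> 'a \<times> 'a \<times> 'a \<times> 'a \<Rightarrow> bool" where
  "coupled_state v0 k (gbar, x, v, u) \<longleftrightarrow>
     (\<forall>y. dual_model v0 k gbar v + (\<eta> + real k * \<mu>) / 2 * (norm (y - v))\<^sup>2 \<le> dual_model v0 k gbar y) \<and>
     u = (1 - 1 / (real k + 1)) *\<^sub>R x + (1 / (real k + 1)) *\<^sub>R v"

abbreviation "run_stage \<equiv> svrda_inner n f L R \<eta>"

lemma ARG_MIN_proximal_le:
  fixes g v :: 'a
  assumes "c > 0"
  defines "h \<equiv> \<lambda>y. g \<bullet> y + R y + c / 2 * (norm (y - v))\<^sup>2"
  shows "h (ARG_MIN h y. True) \<le> h y"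
  unfolding h_def
  by (rule ARG_MIN_le) (rule proximal_minimizer_exists[OF R_convex neg_grad_F_subgradient \<open>c > 0\<close>])

text \<open>
  The gradient of the smooth part gives a subgradient of \<open>R\<close> at the minimizer; adding the exact
  expansion of the quadratic yields growth with the sum of both moduli.
\<close>
lemma proximal_quadratic_growth:
  assumes min: "\<And>y. g \<bullet> z + R z + c / 2 * (norm (z - v))\<^sup>2 \<le> g \<bullet> y + R y + c / 2 * (norm (y - v))\<^sup>2"
  shows "g \<bullet> z + R z + c / 2 * (norm (z - v))\<^sup>2 + (c + \<mu>) / 2 * (norm (y - z))\<^sup>2
           \<le> g \<bullet> y + R y + c / 2 * (norm (y - v))\<^sup>2"
proof -
  have "- (g + c *\<^sub>R (z - v)) \<in> subdifferential R z"
    by (rule minimizer_subgradient[OF R_convex GDERIV_linear_quadratic])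
       (use min in \<open>simp add: algebra_simps\<close>)
  from R_strong_subgradient[OF this, of y]
  have R: "R z - g \<bullet> (y - z) - c * ((z - v) \<bullet> (y - z)) + \<mu> / 2 * (norm (y - z))\<^sup>2 \<le> R y"
    by (simp add: inner_add_left inner_diff_left algebra_simps)
  have "(norm (y - v))\<^sup>2 = (norm (z - v))\<^sup>2 + (norm (y - z))\<^sup>2 + 2 * ((z - v) \<bullet> (y - z))"
    by (simp add: power2_norm_eq_inner inner_diff_left inner_diff_right inner_commute)
  then have "c / 2 * (norm (y - v))\<^sup>2
      = c / 2 * (norm (z - v))\<^sup>2 + c / 2 * (norm (y - z))\<^sup>2 + c * ((z - v) \<bullet> (y - z))"
    by (simp only: distrib_left)
  then show ?thesis
    using R by (simp add: inner_diff_right add_divide_distrib distrib_right)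
qed

lemma coupled_state_run_stage: "coupled_state v0 k (run_stage x0 v0 i k)"
proof (cases k)
  case 0
  then show ?thesis by (simp add: dual_model_def)
next
  case (Suc l)
  obtain gbar x v u where st: "run_stage x0 v0 i l = (gbar, x, v, u)"
    by (metis prod_cases4)
  obtain gbar' x' v' u' where st': "run_stage x0 v0 i k = (gbar', x', v', u')"
    by (metis prod_cases4)
  have k: "real k > 0" using Suc by simp
  (* ARG_MIN is applied to a function, so the coefficient has to be brought literally into the form
     c / 2 before the facts about minimizers apply. *)
  have half: "\<eta> / (2 * real (Suc l)) = \<eta> / real (Suc l) / 2"
    by simp
  have v': "v' = (ARG_MIN (\<lambda>y. gbar' \<bullet> y + R y + \<eta> / real k / 2 * (norm (y - v0))\<^sup>2) y. True)"
    and u': "u' = (1 - 1 / (real k + 1)) *\<^sub>R x' + (1 / (real k + 1)) *\<^sub>R v'"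
    using svrda_inner_Suc_eqs[OF st st'[unfolded Suc]] unfolding Suc half by blast+
  have growth: "gbar' \<bullet> v' + R v' + \<eta> / real k / 2 * (norm (v' - v0))\<^sup>2
           + (\<eta> / real k + \<mu>) / 2 * (norm (y - v'))\<^sup>2
         \<le> gbar' \<bullet> y + R y + \<eta> / real k / 2 * (norm (y - v0))\<^sup>2" for y
    unfolding v' using Lbar_pos k
    by (intro proximal_quadratic_growth ARG_MIN_proximal_le) simp
  have "dual_model v0 k gbar' v' + (\<eta> + real k * \<mu>) / 2 * (norm (y - v'))\<^sup>2 \<le> dual_model v0 k gbar' y" for y
  proof -
    have quadratic: "real k * (\<eta> / real k / 2 * a) = \<eta> / 2 * a"
      "real k * ((\<eta> / real k + \<mu>) / 2 * a) = (\<eta> + real k * \<mu>) / 2 * a" for a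
      using k by (auto simp: field_simps)
    show ?thesis
      using mult_left_mono[OF growth[of y], of "real k"] k
      unfolding distrib_left[of "real k"] quadratic dual_model_def by simp
  qed
  then show ?thesis
    using st' u' by simp
qed

text \<open>
  The proximal point \<open>x'\<close> is compared with \<open>y = (1 - 1/t) x + (1/t) v'\<close>. Since \<open>u\<close> is the same
  combination with \<open>v\<close> for \<open>v'\<close>, the proximal term at \<open>y\<close>, scaled by \<open>t\<close>, equals
  \<open>\<eta> / 2 |v' - v|\<^sup>2\<close>, which the growth of the dual model around \<open>v\<close> compensates. The
  gradient error at \<open>x'\<close> is absorbed by the proximal term \<open>\<eta> t\<^sup>2 / 2 |x' - u|\<^sup>2\<close>, which
  \<open>\<eta> = 4 \<Lambda>\<close> makes large enough to also cover the smoothness term.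
\<close>
lemma potential_step_pathwise:
  assumes st: "run_stage x0 v0 i k = (gbar, x, v, u)"
  defines "\<delta> \<equiv> grad_error x0 u (i (Suc k))"
  shows "potential v0 (Suc k) (run_stage x0 v0 i (Suc k))
    \<le> potential v0 k (run_stage x0 v0 i k) + \<delta> \<bullet> (real k *\<^sub>R (x - u) + (xstar - u))
      - bregman F xstar u + (norm \<delta>)\<^sup>2 / (6 * \<Lambda>)"
proof -
  define t where "t = real (Suc k)"
  define g where "g = svrda_gradient n f L x0 u (i (Suc k))"
  obtain gbar' x' v' u' where st': "run_stage x0 v0 i (Suc k) = (gbar', x', v', u')"
    by (metis prod_cases4)
  have t: "t \<ge> 1" "real k = t - 1" "t > 0" by (simp_all add: t_def)
  have g: "g = \<delta> + grad F u" by (simp add: g_def \<delta>_def)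
  have gbar': "gbar' = (1 - 1 / t) *\<^sub>R gbar + (1 / t) *\<^sub>R g"
    and x': "x' = (ARG_MIN (\<lambda>y. g \<bullet> y + R y + \<eta> * t / 2 * (norm (y - u))\<^sup>2) y. True)"
    using svrda_inner_Suc_eqs[OF st st'] unfolding g_def t_def by blast+
  have model: "dual_model v0 (Suc k) gbar' y = dual_model v0 k gbar y + g \<bullet> y + R y" for y
  proof -
    have "t *\<^sub>R gbar' = real k *\<^sub>R gbar + g"
      using t by (simp add: gbar' scaleR_add_right right_diff_distrib)
    then have "t * (gbar' \<bullet> y) = real k * (gbar \<bullet> y) + g \<bullet> y"
      by (metis inner_add_left inner_scaleR_left)
    moreover have "t * R y = real k * R y + R y"
      by (simp add: t algebra_simps)
    ultimately show ?thesis
      unfolding dual_model_def t_def[symmetric] by linarith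
  qed
  have coupled: "coupled_state v0 k (gbar, x, v, u)"
    using coupled_state_run_stage[of v0 k x0 i] by (simp add: st)
  then have u: "u = (1 - 1 / t) *\<^sub>R x + (1 / t) *\<^sub>R v"
    using t by simp
  have growth: "dual_model v0 k gbar v + \<eta> / 2 * (norm (v' - v))\<^sup>2 \<le> dual_model v0 k gbar v'"
  proof -
    have "\<eta> / 2 * (norm (v' - v))\<^sup>2 \<le> (\<eta> + real k * \<mu>) / 2 * (norm (v' - v))\<^sup>2"
      using mu_nonneg by (intro mult_right_mono divide_right_mono) auto
    moreover have "dual_model v0 k gbar v + (\<eta> + real k * \<mu>) / 2 * (norm (v' - v))\<^sup>2
        \<le> dual_model v0 k gbar v'"
      using coupled by simp
    ultimately show ?thesis by linarith
  qed
  define y where "y = (1 - 1 / t) *\<^sub>R x + (1 / t) *\<^sub>R v'"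
  have y_u: "y - u = (1 / t) *\<^sub>R (v' - v)"
    by (simp add: y_def u algebra_simps)
  have ty: "t *\<^sub>R (y - u) = (t - 1) *\<^sub>R (x - u) + (v' - u)"
  proof -
    have "t *\<^sub>R y = (t - 1) *\<^sub>R x + v'"
      using t by (simp add: y_def scaleR_add_right right_diff_distrib)
    then show ?thesis
      by (simp add: algebra_simps)
  qed
  have prox: "g \<bullet> x' + R x' + \<eta> * t / 2 * (norm (x' - u))\<^sup>2 \<le> g \<bullet> y + R y + \<eta> * t / 2 * (norm (y - u))\<^sup>2"
    unfolding x' using Lbar_pos t by (intro ARG_MIN_proximal_le) simp
  have "R y \<le> (1 - 1 / t) * R x + (1 / t) * R v'"
    unfolding y_def using t by (intro convex_onD[OF R_convex]) auto
  then have Ry: "t * R y \<le> (t - 1) * R x + R v'"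
    using t mult_left_mono[of "R y" _ t] by (simp add: field_simps)
  have sq: "t * (\<eta> * t / 2 * (norm (y - u))\<^sup>2) = \<eta> / 2 * (norm (v' - v))\<^sup>2"
  proof -
    have "norm (y - u) = norm (v' - v) / t"
      unfolding y_u norm_scaleR using t by simp
    then show ?thesis
      using t by (simp add: power2_eq_square)
  qed
  have prox_t: "t * (g \<bullet> (x' - u)) + t * R x' + \<eta> * t\<^sup>2 / 2 * (norm (x' - u))\<^sup>2
      \<le> (t - 1) * (g \<bullet> (x - u)) + g \<bullet> (v' - u) + (t - 1) * R x + R v' + \<eta> / 2 * (norm (v' - v))\<^sup>2"
  proof -
    have "g \<bullet> (x' - u) + R x' + \<eta> * t / 2 * (norm (x' - u))\<^sup>2
        \<le> g \<bullet> (y - u) + R y + \<eta> * t / 2 * (norm (y - u))\<^sup>2"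
      using prox by (simp add: inner_diff_right)
    from mult_left_mono[OF this, of t]
    have "t * (g \<bullet> (x' - u)) + t * R x' + t * (\<eta> * t / 2 * (norm (x' - u))\<^sup>2)
        \<le> t * (g \<bullet> (y - u)) + t * R y + t * (\<eta> * t / 2 * (norm (y - u))\<^sup>2)"
      using t by (simp add: distrib_left)
    moreover have "t * (g \<bullet> (y - u)) = (t - 1) * (g \<bullet> (x - u)) + g \<bullet> (v' - u)"
      using arg_cong[OF ty, of "\<lambda>z. g \<bullet> z"] by (simp add: inner_add_right)
    moreover have "t * (\<eta> * t / 2 * (norm (x' - u))\<^sup>2) = \<eta> * t\<^sup>2 / 2 * (norm (x' - u))\<^sup>2"
      by (simp add: power2_eq_square)
    ultimately show ?thesis
      using Ry sq by linarith
  qed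
  have smooth: "t * F x' \<le> t * F u + t * (grad F u \<bullet> (x' - u)) + t * \<Lambda> / 2 * (norm (x' - u))\<^sup>2"
    using mult_left_mono[OF bregman_F_le_quadratic[of x' u], of t] t
    by (simp add: bregman_def algebra_simps)
  have young: "- (t * (\<delta> \<bullet> (x' - u))) + t * \<Lambda> / 2 * (norm (x' - u))\<^sup>2 - \<eta> * t\<^sup>2 / 2 * (norm (x' - u))\<^sup>2
      \<le> (norm \<delta>)\<^sup>2 / (6 * \<Lambda>)"
  proof -
    let ?w = "x' - u"
    (* The proximal term exceeds the smoothness term by (4 t^2 - t) \<Lambda> / 2 |w|^2, which is at least
       3 t^2 \<Lambda> / 2 |w|^2 because t \<ge> 1; the square is completed with this weight. *)
    have "0 \<le> (norm (\<delta> + (3 * \<Lambda> * t) *\<^sub>R ?w))\<^sup>2 / (6 * \<Lambda>)"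
      using Lbar_pos by simp
    also have "\<dots> = (norm \<delta>)\<^sup>2 / (6 * \<Lambda>) + t * (\<delta> \<bullet> ?w) + 3 * \<Lambda> * t\<^sup>2 / 2 * (norm ?w)\<^sup>2"
    proof -
      have "(norm (\<delta> + (3 * \<Lambda> * t) *\<^sub>R ?w))\<^sup>2
          = (norm \<delta>)\<^sup>2 + 6 * \<Lambda> * (t * (\<delta> \<bullet> ?w)) + (3 * \<Lambda> * t)\<^sup>2 * (norm ?w)\<^sup>2"
        unfolding power2_norm_eq_inner inner_add_left inner_add_right inner_scaleR_left
          inner_scaleR_right inner_commute[of ?w \<delta>] by (simp add: power2_eq_square algebra_simps)
      then show ?thesis
        using Lbar_pos by (simp add: add_divide_distrib power2_eq_square)
    qed
    finally have 1: "- (t * (\<delta> \<bullet> ?w)) \<le> (norm \<delta>)\<^sup>2 / (6 * \<Lambda>) + 3 * \<Lambda> * t\<^sup>2 / 2 * (norm ?w)\<^sup>2"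
      by linarith
    have "t * \<Lambda> + 3 * \<Lambda> * t\<^sup>2 \<le> \<eta> * t\<^sup>2"
      using t Lbar_pos by (simp add: power2_eq_square)
    then have "(t * \<Lambda> + 3 * \<Lambda> * t\<^sup>2) / 2 * (norm ?w)\<^sup>2 \<le> \<eta> * t\<^sup>2 / 2 * (norm ?w)\<^sup>2"
      by (intro mult_right_mono divide_right_mono) auto
    then have "t * \<Lambda> / 2 * (norm ?w)\<^sup>2 + 3 * \<Lambda> * t\<^sup>2 / 2 * (norm ?w)\<^sup>2 \<le> \<eta> * t\<^sup>2 / 2 * (norm ?w)\<^sup>2"
      by (simp only: add_divide_distrib distrib_right)
    then show ?thesis
      using 1 by linarith
  qed
  have convex: "(t - 1) * (F u + grad F u \<bullet> (x - u)) \<le> (t - 1) * F x"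
    using t bregman_F_nonneg[of x u] by (intro mult_left_mono) (auto simp: bregman_def)
  have g_split: "g \<bullet> z = \<delta> \<bullet> z + grad F u \<bullet> z" for z
    by (simp add: g inner_add_left)
  have "t * (F x' + R x') \<le> (t - 1) * (F x + R x) + (t - 1) * (\<delta> \<bullet> (x - u))
      + F u + g \<bullet> (v' - u) + R v' + \<eta> / 2 * (norm (v' - v))\<^sup>2 + (norm \<delta>)\<^sup>2 / (6 * \<Lambda>)"
    using prox_t smooth young convex unfolding g_split[of "x' - u"] g_split[of "x - u"]
    by (simp only: distrib_left left_diff_distrib mult_1)
  moreover have "potential v0 (Suc k) (run_stage x0 v0 i (Suc k)) =
      t * (F x' + R x') - t * P xstar + (dual_model v0 k gbar xstar + g \<bullet> xstar + R xstar
        - (dual_model v0 k gbar v' + g \<bullet> v' + R v'))"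
    unfolding st' potential.simps model t_def[symmetric] by (simp add: objective_def right_diff_distrib)
  moreover have "potential v0 k (run_stage x0 v0 i k) =
      (t - 1) * (F x + R x) - (t - 1) * P xstar + (dual_model v0 k gbar xstar - dual_model v0 k gbar v)"
    unfolding st potential.simps t(2) by (simp add: objective_def right_diff_distrib)
  moreover have "t * P xstar = (t - 1) * P xstar + F xstar + R xstar"
    by (simp add: objective_def algebra_simps)
  moreover have "\<delta> \<bullet> (real k *\<^sub>R (x - u) + (xstar - u)) = (t - 1) * (\<delta> \<bullet> (x - u)) + \<delta> \<bullet> (xstar - u)"
    by (simp add: inner_add_right t(2))
  moreover have "\<delta> \<bullet> (xstar - u) = g \<bullet> xstar - g \<bullet> u - grad F u \<bullet> (xstar - u)"
    by (simp add: g inner_diff_right inner_add_left)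
  ultimately show ?thesis
    using growth unfolding bregman_def inner_diff_right[of g] by linarith
qed

text \<open>
  Averaging the pathwise estimate over the last draw removes the term linear in the gradient
  error, and the divergence \<open>bregman F xstar u\<close> gained there cancels the one in the variance. What
  remains of the variance is measured at the reference point \<open>x0\<close> of the stage.
\<close>
lemma potential_step_mean:
  "(\<Sum>j=1..n. q j * potential v0 (Suc k) (run_stage x0 v0 (i(Suc k := j)) (Suc k)))
     \<le> potential v0 k (run_stage x0 v0 i k)
       + (1 / 2 * (P x0 - P xstar) - \<mu> / 4 * (norm (x0 - xstar))\<^sup>2)"
proof -
  obtain gbar x v u where st: "run_stage x0 v0 i k = (gbar, x, v, u)"
    by (metis prod_cases4)
  define \<Phi> where "\<Phi> = potential v0 k (run_stage x0 v0 i k)"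
  define D where "D = bregman F xstar u"
  define z where "z = real k *\<^sub>R (x - u) + (xstar - u)"
  define \<delta> where "\<delta> j = grad_error x0 u j" for j
  have "potential v0 (Suc k) (run_stage x0 v0 (i(Suc k := j)) (Suc k))
      \<le> \<Phi> + \<delta> j \<bullet> z - D + (norm (\<delta> j))\<^sup>2 / (6 * \<Lambda>)" for j
  proof -
    have "run_stage x0 v0 (i(Suc k := j)) k = run_stage x0 v0 i k"
      by (rule svrda_inner_cong) auto
    then show ?thesis
      using potential_step_pathwise[of x0 v0 "i(Suc k := j)" k gbar x v u] st
      by (simp add: \<Phi>_def D_def z_def \<delta>_def)
  qed
  then have "(\<Sum>j=1..n. q j * potential v0 (Suc k) (run_stage x0 v0 (i(Suc k := j)) (Suc k)))
      \<le> (\<Sum>j=1..n. q j * (\<Phi> + \<delta> j \<bullet> z - D + (norm (\<delta> j))\<^sup>2 / (6 * \<Lambda>)))"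
    using q_pos by (intro sum_mono mult_left_mono) (auto simp: less_imp_le)
  also have "\<dots> = (\<Sum>j=1..n. q j * (\<Phi> - D) + (q j *\<^sub>R \<delta> j) \<bullet> z + q j * (norm (\<delta> j))\<^sup>2 / (6 * \<Lambda>))"
    by (intro sum.cong refl) (simp add: algebra_simps)
  also have "\<dots> = (\<Sum>j=1..n. q j) * (\<Phi> - D) + (\<Sum>j=1..n. q j *\<^sub>R \<delta> j) \<bullet> z
      + (\<Sum>j=1..n. q j * (norm (\<delta> j))\<^sup>2) / (6 * \<Lambda>)"
    by (simp only: sum.distrib sum_distrib_right inner_sum_left sum_divide_distrib)
  also have "\<dots> = \<Phi> - D + (\<Sum>j=1..n. q j * (norm (\<delta> j))\<^sup>2) / (6 * \<Lambda>)"
    by (simp only: sum_q \<delta>_def grad_error_mean) simp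
  also have "\<dots> \<le> \<Phi> - D + (6 * \<Lambda> * D + 3 * \<Lambda> * bregman F x0 xstar) / (6 * \<Lambda>)"
    using grad_error_second_moment[of x0 u] Lbar_pos
    by (intro add_left_mono divide_right_mono) (auto simp: \<delta>_def D_def)
  also have "\<dots> = \<Phi> + bregman F x0 xstar / 2"
    using Lbar_pos by (simp add: add_divide_distrib)
  also have "\<dots> \<le> \<Phi> + (1 / 2 * (P x0 - P xstar) - \<mu> / 4 * (norm (x0 - xstar))\<^sup>2)"
    using bregman_le_objective_gap[of x0] by (simp add: field_simps)
  finally show ?thesis
    by (simp only: \<Phi>_def)
qed

lemma potential_initial:
  "potential v0 0 (run_stage x0 v0 i 0) = \<eta> / 2 * (norm (v0 - xstar))\<^sup>2"
  by (simp add: dual_model_def norm_minus_commute)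

text \<open>What the potential controls at the end of a stage, by the growth of the dual model at \<open>xstar\<close>.\<close>
lemma potential_final:
  assumes "run_stage x0 v0 i k = (gbar, x, v, u)"
  shows "real k * (P x - P xstar) + (\<eta> + real k * \<mu>) / 2 * (norm (v - xstar))\<^sup>2
           \<le> potential v0 k (run_stage x0 v0 i k)"
proof -
  have "dual_model v0 k gbar v + (\<eta> + real k * \<mu>) / 2 * (norm (xstar - v))\<^sup>2
      \<le> dual_model v0 k gbar xstar"
    using coupled_state_run_stage[of v0 k x0 i] assms by simp
  then show ?thesis
    using assms by (simp add: norm_minus_commute)
qed

end

section \<open>Expectations over finitely many independent draws\<close>

lemma has_bochner_integral_mono:
  fixes f g :: "'a \<Rightarrow> real"
  assumes "has_bochner_integral M f x" "has_bochner_integral M g y" "\<And>\<omega>. f \<omega> \<le> g \<omega>"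
  shows "x \<le> y"
  using assms integral_mono[of M f g] by (simp add: has_bochner_integral_iff)

text \<open>
  The expectation of \<open>h\<close> when the coordinates in \<open>J\<close> are drawn independently from the finite set
  \<open>A\<close> with weights \<open>q\<close>. Written as a finite sum, it is linear in \<open>h\<close> and can be split coordinatewise for every
  \<open>h\<close>, so that conditioning is a manipulation of sums.
\<close>
definition path_mean :: "('b \<Rightarrow> real) \<Rightarrow> 'b set \<Rightarrow> 'j set \<Rightarrow> (('j \<Rightarrow> 'b) \<Rightarrow> real) \<Rightarrow> real" where
  "path_mean q A J h = (\<Sum>p\<in>J \<rightarrow>\<^sub>E A. (\<Prod>j\<in>J. q (p j)) * h p)"

lemma path_mean_mono:
  assumes "\<And>y. y \<in> A \<Longrightarrow> q y \<ge> 0" "\<And>p. h p \<le> h' p"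
  shows "path_mean q A J h \<le> path_mean q A J h'"
  unfolding path_mean_def
  using assms by (intro sum_mono mult_left_mono prod_nonneg) (auto dest: PiE_mem)

text \<open>Fubini for the coordinate \<open>a\<close>: this is the conditional expectation given the draws in \<open>J\<close>.\<close>
lemma path_mean_insert:
  assumes J: "finite J" "a \<notin> J"
  shows "path_mean q A (insert a J) h = path_mean q A J (\<lambda>p. \<Sum>y\<in>A. q y * h (p(a := y)))"
proof -
  have "path_mean q A (insert a J) h
      = (\<Sum>(y, p)\<in>A \<times> (J \<rightarrow>\<^sub>E A). (\<Prod>j\<in>insert a J. q ((p(a := y)) j)) * h (p(a := y)))"
    unfolding path_mean_def PiE_insert_eq
    by (subst sum.reindex[OF inj_combinator[OF J(2)]]) (simp add: case_prod_unfold)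
  also have "\<dots> = (\<Sum>(y, p)\<in>A \<times> (J \<rightarrow>\<^sub>E A). (\<Prod>j\<in>J. q (p j)) * (q y * h (p(a := y))))"
  proof (intro sum.cong refl, clarify)
    fix y p
    have "(\<Prod>j\<in>J. q ((p(a := y)) j)) = (\<Prod>j\<in>J. q (p j))"
      using J(2) by (intro prod.cong refl) auto
    then show "(\<Prod>j\<in>insert a J. q ((p(a := y)) j)) * h (p(a := y))
        = (\<Prod>j\<in>J. q (p j)) * (q y * h (p(a := y)))"
      using J by (simp add: prod.insert)
  qed
  also have "\<dots> = (\<Sum>p\<in>J \<rightarrow>\<^sub>E A. \<Sum>y\<in>A. (\<Prod>j\<in>J. q (p j)) * (q y * h (p(a := y))))"
    by (subst sum.swap) (simp add: sum.cartesian_product)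
  finally show ?thesis
    by (simp add: path_mean_def sum_distrib_left)
qed

text \<open>
  Almost surely all draws lie in \<open>A\<close>, and there the random variable is a finite linear combination
  of the indicators of the events that the draws follow a given path; independence gives the
  probability of such an event as a product. Measurability holds because the draws take values in a
  countable set.
\<close>
lemma (in prob_space) has_bochner_integral_path_mean:
  fixes X :: "'j \<Rightarrow> 'a \<Rightarrow> 'b::countable" and h :: "('j \<Rightarrow> 'b) \<Rightarrow> real"
  assumes indep: "indep_vars (\<lambda>_. count_space UNIV) X K"
    and J: "finite J" "J \<subseteq> K"
    and A: "finite A" "sum q A = 1"
    and law: "\<And>j y. j \<in> J \<Longrightarrow> y \<in> A \<Longrightarrow> prob {\<omega> \<in> space M. X j \<omega> = y} = q y"
    and local: "\<And>p p'. (\<And>j. j \<in> J \<Longrightarrow> p j = p' j) \<Longrightarrow> h p = h p'"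
  shows "has_bochner_integral M (\<lambda>\<omega>. h (\<lambda>j. X j \<omega>)) (path_mean q A J h)"
proof -
  have X[measurable]: "X j \<in> measurable M (count_space UNIV)" if "j \<in> J" for j
    using indep J that by (auto simp: indep_vars_def)
  define E where "E p = {\<omega> \<in> space M. \<forall>j\<in>J. X j \<omega> = p j}" for p
  have E[measurable]: "E p \<in> events" for p
    unfolding E_def using J(1) by measurable
  have prob_E: "prob (E p) = (\<Prod>j\<in>J. q (p j))" if p: "p \<in> J \<rightarrow>\<^sub>E A" for p
  proof (cases "J = {}")
    case True
    then show ?thesis by (simp add: E_def prob_space)
  next
    case False
    have "E p = (\<Inter>j\<in>J. X j -` {p j} \<inter> space M)"
      using False by (auto simp: E_def)
    then have "prob (E p) = (\<Prod>j\<in>J. prob (X j -` {p j} \<inter> space M))"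
      using indep_varsD[OF indep False J, of "\<lambda>j. {p j}"] by simp
    also have "\<dots> = (\<Prod>j\<in>J. q (p j))"
    proof (intro prod.cong refl)
      fix j assume j: "j \<in> J"
      have "X j -` {p j} \<inter> space M = {\<omega> \<in> space M. X j \<omega> = p j}"
        by auto
      then show "prob (X j -` {p j} \<inter> space M) = q (p j)"
        using law[OF j] PiE_mem[OF p j] by simp
    qed
    finally show ?thesis .
  qed
  have "AE \<omega> in M. X j \<omega> \<in> A" if j: "j \<in> J" for j
  proof -
    note X[OF j, measurable]
    have "prob (\<Union>y\<in>A. {\<omega> \<in> space M. X j \<omega> = y}) = (\<Sum>y\<in>A. prob {\<omega> \<in> space M. X j \<omega> = y})"
      by (intro finite_measure_finite_Union A) (auto simp: disjoint_family_on_def)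
    also have "\<dots> = 1"
      using A(2) law[OF j] by simp
    also have "(\<Union>y\<in>A. {\<omega> \<in> space M. X j \<omega> = y}) = {\<omega> \<in> space M. X j \<omega> \<in> A}"
      by auto
    finally have "AE \<omega> in M. \<omega> \<in> {\<omega> \<in> space M. X j \<omega> \<in> A}"
      by (subst AE_in_set_eq_1) auto
    then show ?thesis by auto
  qed
  then have in_A: "AE \<omega> in M. \<forall>j\<in>J. X j \<omega> \<in> A"
    using J(1) by (intro AE_finite_allI) auto
  let ?g = "\<lambda>\<omega>. \<Sum>p\<in>J \<rightarrow>\<^sub>E A. indicator (E p) \<omega> * h p"
  have "has_bochner_integral M ?g (\<Sum>p\<in>J \<rightarrow>\<^sub>E A. prob (E p) * h p)"
    by (intro has_bochner_integral_sum has_bochner_integral_mult_left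
        has_bochner_integral_real_indicator) (auto simp: less_top[symmetric])
  then have g: "has_bochner_integral M ?g (path_mean q A J h)"
    by (simp add: path_mean_def prob_E cong: sum.cong)
  have eq: "AE \<omega> in M. ?g \<omega> = h (\<lambda>j. X j \<omega>)"
    using in_A AE_space
  proof eventually_elim
    case (elim \<omega>)
    let ?p = "\<lambda>j\<in>J. X j \<omega>"
    have p: "?p \<in> J \<rightarrow>\<^sub>E A"
      using elim by auto
    have "?g \<omega> = (\<Sum>p\<in>J \<rightarrow>\<^sub>E A. if p = ?p then h p else 0)"
    proof (intro sum.cong refl)
      fix p assume "p \<in> J \<rightarrow>\<^sub>E A"
      then have "\<omega> \<in> E p \<longleftrightarrow> p = ?p"
        using elim by (auto simp: E_def fun_eq_iff PiE_def extensional_def)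
      then show "indicator (E p) \<omega> * h p = (if p = ?p then h p else 0)"
        by (simp add: indicator_def)
    qed
    also have "\<dots> = h ?p"
      using p J(1) A(1) by (simp add: finite_PiE)
    also have "\<dots> = h (\<lambda>j. X j \<omega>)"
      by (rule local) simp
    finally show ?case .
  qed
  have "(\<lambda>\<omega>. h (\<lambda>j. X j \<omega>)) \<in> borel_measurable M"
  proof -
    have "(\<lambda>\<omega>. \<lambda>j\<in>J. X j \<omega>) \<in> measurable M (count_space (J \<rightarrow>\<^sub>E UNIV))"
    proof (subst measurable_count_space_eq_countable)
      show "countable (J \<rightarrow>\<^sub>E (UNIV :: 'b set))"
        using J(1) by (intro countable_PiE) auto
      have "(\<lambda>\<omega>. \<lambda>j\<in>J. X j \<omega>) -` {p} \<inter> space M = E p" if "p \<in> J \<rightarrow>\<^sub>E UNIV" for p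
        using that by (auto simp: E_def fun_eq_iff PiE_def extensional_def)
      then show "(\<lambda>\<omega>. \<lambda>j\<in>J. X j \<omega>) \<in> space M \<rightarrow> (J \<rightarrow>\<^sub>E UNIV) \<and>
          (\<forall>p\<in>J \<rightarrow>\<^sub>E UNIV. (\<lambda>\<omega>. \<lambda>j\<in>J. X j \<omega>) -` {p} \<inter> space M \<in> events)"
        using E by auto
    qed
    then have "(\<lambda>\<omega>. h (\<lambda>j\<in>J. X j \<omega>)) \<in> borel_measurable M"
      by (rule measurable_compose) simp
    moreover have "h (\<lambda>j\<in>J. X j \<omega>) = h (\<lambda>j. X j \<omega>)" for \<omega>
      by (rule local) simp
    ultimately show ?thesis by simp
  qed
  from has_bochner_integralI_AE[OF g this eq] show ?thesis .
qed

section \<open>The recursion over stages\<close>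

lemma norm_convex_combination_power2_le:
  fixes a b :: "'a::real_inner"
  assumes "0 \<le> \<alpha>" "\<alpha> \<le> 1"
  shows "(norm ((1 - \<alpha>) *\<^sub>R a + \<alpha> *\<^sub>R b))\<^sup>2 \<le> (1 - \<alpha>) * (norm a)\<^sup>2 + \<alpha> * (norm b)\<^sup>2"
proof -
  have "(1 - \<alpha>) * (norm a)\<^sup>2 + \<alpha> * (norm b)\<^sup>2 - (norm ((1 - \<alpha>) *\<^sub>R a + \<alpha> *\<^sub>R b))\<^sup>2
      = \<alpha> * (1 - \<alpha>) * (norm (a - b))\<^sup>2"
    unfolding power2_norm_eq_inner inner_add_left inner_add_right inner_diff_left inner_diff_right
      inner_scaleR_left inner_scaleR_right inner_commute[of b a] by algebra
  also have "\<dots> \<ge> 0"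
    using assms by simp
  finally show ?thesis by simp
qed

lemma svrda_cong:
  assumes "\<And>s t. s \<in> {1..k} \<Longrightarrow> t \<in> {1..stage_length \<mu> m1 s} \<Longrightarrow> i s t = i' s t"
  shows "svrda n f L R \<mu> \<eta> \<alpha> m1 xt0 i k = svrda n f L R \<mu> \<eta> \<alpha> m1 xt0 i' k"
  using assms
proof (induction k)
  case (Suc k)
  have "svrda n f L R \<mu> \<eta> \<alpha> m1 xt0 i k = svrda n f L R \<mu> \<eta> \<alpha> m1 xt0 i' k"
    by (rule Suc.IH) (use Suc.prems in auto)
  moreover have "svrda_inner n f L R \<eta> x v (i (Suc k)) (stage_length \<mu> m1 (Suc k))
      = svrda_inner n f L R \<eta> x v (i' (Suc k)) (stage_length \<mu> m1 (Suc k))" for x v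
    by (rule svrda_inner_cong) (use Suc.prems in auto)
  ultimately show ?case by simp
qed simp

context composite_problem
begin

text \<open>
  This bounds half the Bregman divergence from \<open>xstar\<close> to \<open>x0\<close>, the part of the variance that
  survives each step of a stage with reference point \<open>x0\<close>.
\<close>
definition stage_cost :: "'a \<Rightarrow> real" where
  "stage_cost x0 = 1 / 2 * (P x0 - P xstar) - \<mu> / 4 * (norm (x0 - xstar))\<^sup>2"

text \<open>
  Subtracting the accumulated cost makes the potential a supermartingale along the draws of stage
  \<open>s\<close>. The starting points \<open>x0\<close> and \<open>v0\<close> of the stage are themselves functions of the draws in
  \<open>J\<close>, those of the earlier stages.
\<close>
lemma potential_supermartingale:
  fixes x0 v0 :: "(nat \<times> nat \<Rightarrow> nat) \<Rightarrow> 'a"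
  assumes J: "finite J" "\<And>t. (s, t) \<notin> J"
    and x0: "\<And>p p'. (\<And>j. j \<in> J \<Longrightarrow> p j = p' j) \<Longrightarrow> x0 p = x0 p'"
    and v0: "\<And>p p'. (\<And>j. j \<in> J \<Longrightarrow> p j = p' j) \<Longrightarrow> v0 p = v0 p'"
  defines "\<Psi> \<equiv> \<lambda>k p. potential (v0 p) k (run_stage (x0 p) (v0 p) (\<lambda>t. p (s, t)) k)
                     - real k * stage_cost (x0 p)"
  shows "path_mean q {1..n} (J \<union> {s} \<times> {1..k}) (\<Psi> k) \<le> path_mean q {1..n} J (\<Psi> 0)"
proof (induction k)
  case 0
  then show ?case by simp
next
  case (Suc k)
  let ?J = "J \<union> {s} \<times> {1..k}" and ?a = "(s, Suc k)"
  have step: "(\<Sum>y=1..n. q y * \<Psi> (Suc k) (p(?a := y))) \<le> \<Psi> k p" for p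
  proof -
    have "x0 (p(?a := y)) = x0 p" "v0 (p(?a := y)) = v0 p" for y
      using J(2) by (auto intro!: x0 v0)
    moreover have "(\<lambda>t. (p(?a := y)) (s, t)) = (\<lambda>t. p (s, t))(Suc k := y)" for y
      by auto
    ultimately have "(\<Sum>y=1..n. q y * \<Psi> (Suc k) (p(?a := y)))
        = (\<Sum>y=1..n. q y * potential (v0 p) (Suc k)
             (run_stage (x0 p) (v0 p) ((\<lambda>t. p (s, t))(Suc k := y)) (Suc k)))
          - (\<Sum>y=1..n. q y) * (real (Suc k) * stage_cost (x0 p))"
      unfolding \<Psi>_def by (simp only: right_diff_distrib sum_subtractf sum_distrib_right)
    also have "\<dots> \<le> \<Psi> k p"
      unfolding sum_q \<Psi>_def
      using potential_step_mean[of "v0 p" k "x0 p" "\<lambda>t. p (s, t)", folded stage_cost_def]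
      by (simp add: distrib_right del: svrda_inner.simps)
    finally show ?thesis .
  qed
  have "J \<union> {s} \<times> {1..Suc k} = insert ?a ?J"
    by auto
  then have "path_mean q {1..n} (J \<union> {s} \<times> {1..Suc k}) (\<Psi> (Suc k))
      = path_mean q {1..n} ?J (\<lambda>p. \<Sum>y=1..n. q y * \<Psi> (Suc k) (p(?a := y)))"
    using J by (simp add: path_mean_insert)
  also have "\<dots> \<le> path_mean q {1..n} ?J (\<Psi> k)"
    using q_pos step by (intro path_mean_mono) (auto simp: less_imp_le)
  also note Suc.IH
  finally show ?case .
qed

text \<open>
  The start of stage \<open>k + 1\<close> depends on the draws in \<open>J\<close> and its end on those in \<open>J'\<close>. Integrals of
  the potential at these times become the corresponding path means, which the supermartingale property
  compares.
\<close>
lemma svrda_stage_recursion: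
  fixes M :: "'w measure" and I :: "nat \<Rightarrow> nat \<Rightarrow> 'w \<Rightarrow> nat" 
    and \<alpha> :: real and m1 k :: nat and xt0 :: 'a
  assumes m1: "m1 \<ge> 1" and \<alpha>: "0 \<le> \<alpha>" "\<alpha> \<le> 1"
    and M: "prob_space M" and draws: "svrda_draws M n L (stage_length \<mu> m1) I"
  defines "m \<equiv> real (stage_length \<mu> m1 (Suc k))"
    and "xs \<equiv> svrda_x n f L R \<mu> \<eta> \<alpha> m1 xt0 I" and "vs \<equiv> svrda_v n f L R \<mu> \<eta> \<alpha> m1 xt0 I"
  shows "(\<integral>\<omega>. P (xs (Suc k) \<omega>) - P xstar \<partial>M)
       + (\<eta> + m * \<mu>) / (2 * m) * (\<integral>\<omega>. (norm (vs (Suc k) \<omega> - xstar))\<^sup>2 \<partial>M)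
     \<le> 1 / 2 * (\<integral>\<omega>. P (xs k \<omega>) - P xstar \<partial>M)
       + (\<alpha> * \<eta> / (2 * m) - \<mu> / 4) * (\<integral>\<omega>. (norm (xs k \<omega> - xstar))\<^sup>2 \<partial>M)
       + (1 - \<alpha>) * \<eta> / (2 * m) * (\<integral>\<omega>. (norm (vs k \<omega> - xstar))\<^sup>2 \<partial>M)"
proof -
  interpret prob_space M by (rule M)
  let ?len = "stage_length \<mu> m1" and ?X = "\<lambda>(s, t). I s t"
  have m: "m > 0" using m1 by (simp add: m_def stage_length_def)
  define J where "J = (SIGMA s:{1..k}. {1..?len s})"
  define J' where "J' = J \<union> {Suc k} \<times> {1..?len (Suc k)}"
  have J'_eq: "J' = (SIGMA s:{1..Suc k}. {1..?len s})"
    by (auto simp: J_def J'_def atLeastAtMostSuc_conv)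
  have J: "finite J" "\<And>t. (Suc k, t) \<notin> J"
    by (auto simp: J_def)
  have indep: "indep_vars (\<lambda>_. count_space UNIV) ?X (SIGMA s:{1..}. {1..?len s})"
    and law: "\<And>s t y. s \<ge> 1 \<Longrightarrow> t \<in> {1..?len s} \<Longrightarrow> y \<in> {1..n} \<Longrightarrow>
      prob {\<omega> \<in> space M. I s t \<omega> = y} = q y"
    using draws by (auto simp: svrda_draws_def)
  have mean': "has_bochner_integral M (\<lambda>\<omega>. h (\<lambda>j. ?X j \<omega>)) (path_mean q {1..n} J' h)"
    if h: "\<And>p p'. (\<And>j. j \<in> J' \<Longrightarrow> p j = p' j) \<Longrightarrow> h p = h p'" for h
  proof (rule has_bochner_integral_path_mean[OF indep _ _ finite_atLeastAtMost sum_q _ h])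
    show "finite J'" "J' \<subseteq> (SIGMA s:{1..}. {1..?len s})"
      by (auto simp: J'_eq)
    show "prob {\<omega> \<in> space M. ?X j \<omega> = y} = q y" if "j \<in> J'" "y \<in> {1..n}" for j y
      using that law by (cases j) (simp add: J'_eq)
  qed
  have mean: "has_bochner_integral M (\<lambda>\<omega>. h (\<lambda>j. ?X j \<omega>)) (path_mean q {1..n} J h)"
    if h: "\<And>p p'. (\<And>j. j \<in> J \<Longrightarrow> p j = p' j) \<Longrightarrow> h p = h p'" for h
  proof (rule has_bochner_integral_path_mean[OF indep _ _ finite_atLeastAtMost sum_q _ h])
    show "finite J" "J \<subseteq> (SIGMA s:{1..}. {1..?len s})"
      by (auto simp: J_def)
    show "prob {\<omega> \<in> space M. ?X j \<omega> = y} = q y" if "j \<in> J" "y \<in> {1..n}" for j y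
      using that law by (cases j) (simp add: J_def)
  qed

  define iter where "iter k p = svrda n f L R \<mu> \<eta> \<alpha> m1 xt0 (\<lambda>s t. p (s, t)) k" for k p
  have iter: "iter k p = iter k p'" if "\<And>j. j \<in> J \<Longrightarrow> p j = p' j" for p p'
    unfolding iter_def by (rule svrda_cong) (use that in \<open>auto simp: J_def\<close>)
  have iter': "iter (Suc k) p = iter (Suc k) p'" if "\<And>j. j \<in> J' \<Longrightarrow> p j = p' j" for p p'
    unfolding iter_def by (rule svrda_cong) (use that in \<open>auto simp: J'_eq\<close>)
  have xs: "xs l \<omega> = fst (iter l (\<lambda>j. ?X j \<omega>))" and vs: "vs l \<omega> = snd (iter l (\<lambda>j. ?X j \<omega>))" for l \<omega>
    by (simp_all add: xs_def vs_def svrda_x_def svrda_v_def iter_def)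

  define x0 where "x0 p = fst (iter k p)" for p
  define v0 where "v0 p = (1 - \<alpha>) *\<^sub>R snd (iter k p) + \<alpha> *\<^sub>R fst (iter k p)" for p
  have x0: "x0 p = x0 p'" and v0: "v0 p = v0 p'" if "\<And>j. j \<in> J \<Longrightarrow> p j = p' j" for p p'
    using iter[OF that] by (simp_all add: x0_def v0_def)
  define \<Psi> where "\<Psi> l p = potential (v0 p) l (run_stage (x0 p) (v0 p) (\<lambda>t. p (Suc k, t)) l)
                     - real l * stage_cost (x0 p)" for l p
  have \<Psi>_mean: "path_mean q {1..n} J' (\<Psi> (?len (Suc k))) \<le> path_mean q {1..n} J (\<Psi> 0)"
    unfolding \<Psi>_def J'_def using J x0 v0 by (rule potential_supermartingale)
  have \<Psi>': "has_bochner_integral M (\<lambda>\<omega>. \<Psi> (?len (Suc k)) (\<lambda>j. ?X j \<omega>))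
      (path_mean q {1..n} J' (\<Psi> (?len (Suc k))))"
  proof (rule mean')
    fix p p' :: "nat \<times> nat \<Rightarrow> nat" assume eq: "\<And>j. j \<in> J' \<Longrightarrow> p j = p' j"
    have "x0 p = x0 p'" "v0 p = v0 p'"
      using eq by (auto simp: J'_def intro!: x0 v0)
    moreover have "run_stage x v (\<lambda>t. p (Suc k, t)) (?len (Suc k))
        = run_stage x v (\<lambda>t. p' (Suc k, t)) (?len (Suc k))" for x v
      by (rule svrda_inner_cong) (use eq in \<open>auto simp: J'_def\<close>)
    ultimately show "\<Psi> (?len (Suc k)) p = \<Psi> (?len (Suc k)) p'"
      by (simp add: \<Psi>_def)
  qed
  have \<Psi>0_eq: "\<Psi> 0 p = \<eta> / 2 * (norm (v0 p - xstar))\<^sup>2" for p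
    unfolding \<Psi>_def potential_initial by simp
  have \<Psi>0: "has_bochner_integral M (\<lambda>\<omega>. \<Psi> 0 (\<lambda>j. ?X j \<omega>)) (path_mean q {1..n} J (\<Psi> 0))"
  proof (rule mean)
    show "\<Psi> 0 p = \<Psi> 0 p'" if "\<And>j. j \<in> J \<Longrightarrow> p j = p' j" for p p'
      unfolding \<Psi>0_eq by (subst v0[OF that]) simp_all
  qed

  have lower: "m * (P (fst (iter (Suc k) p)) - P xstar)
        + (\<eta> + m * \<mu>) / 2 * (norm (snd (iter (Suc k) p) - xstar))\<^sup>2
        - m * stage_cost (x0 p) \<le> \<Psi> (?len (Suc k)) p" for p
  proof -
    obtain gbar x v u where st:
      "run_stage (x0 p) (v0 p) (\<lambda>t. p (Suc k, t)) (?len (Suc k)) = (gbar, x, v, u)"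
      by (metis prod_cases4)
    then have "iter (Suc k) p = (x, v)"
      by (simp add: iter_def x0_def v0_def case_prod_unfold)
    then show ?thesis
      using potential_final[OF st] by (simp add: \<Psi>_def m_def)
  qed
  have upper: "\<Psi> 0 p \<le> \<eta> / 2 * ((1 - \<alpha>) * (norm (snd (iter k p) - xstar))\<^sup>2
                                    + \<alpha> * (norm (fst (iter k p) - xstar))\<^sup>2)" for p
  proof -
    have "v0 p - xstar = (1 - \<alpha>) *\<^sub>R (snd (iter k p) - xstar) + \<alpha> *\<^sub>R (fst (iter k p) - xstar)"
      by (simp add: v0_def algebra_simps)
    then show ?thesis
      unfolding \<Psi>0_eq using norm_convex_combination_power2_le[OF \<alpha>] Lbar_pos
      by (intro mult_left_mono) auto
  qed

  have integrable': "integrable M (\<lambda>\<omega>. \<phi> (iter (Suc k) (\<lambda>j. ?X j \<omega>)))" for \<phi> :: "'a \<times> 'a \<Rightarrow> real"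
  proof (rule integrable.intros, rule mean'[of "\<lambda>p. \<phi> (iter (Suc k) p)"])
    show "\<phi> (iter (Suc k) p) = \<phi> (iter (Suc k) p')" if "\<And>j. j \<in> J' \<Longrightarrow> p j = p' j" for p p'
      by (subst iter'[OF that]) simp_all
  qed
  have integrable: "integrable M (\<lambda>\<omega>. \<phi> (iter k (\<lambda>j. ?X j \<omega>)))" for \<phi> :: "'a \<times> 'a \<Rightarrow> real"
  proof (rule integrable.intros, rule mean[of "\<lambda>p. \<phi> (iter k p)"])
    show "\<phi> (iter k p) = \<phi> (iter k p')" if "\<And>j. j \<in> J \<Longrightarrow> p j = p' j" for p p'
      by (subst iter[OF that]) simp_all
  qed
  have int': "integrable M (\<lambda>\<omega>. P (xs (Suc k) \<omega>) - P xstar)"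
      "integrable M (\<lambda>\<omega>. (norm (vs (Suc k) \<omega> - xstar))\<^sup>2)"
    unfolding xs vs by (rule integrable')+
  have int: "integrable M (\<lambda>\<omega>. P (xs k \<omega>) - P xstar)"
      "integrable M (\<lambda>\<omega>. (norm (xs k \<omega> - xstar))\<^sup>2)"
      "integrable M (\<lambda>\<omega>. (norm (vs k \<omega> - xstar))\<^sup>2)"
    unfolding xs vs by (rule integrable)+
  define a where "a = (\<integral>\<omega>. P (xs (Suc k) \<omega>) - P xstar \<partial>M)"
  define b where "b = (\<integral>\<omega>. (norm (vs (Suc k) \<omega> - xstar))\<^sup>2 \<partial>M)"
  define c where "c = (\<integral>\<omega>. P (xs k \<omega>) - P xstar \<partial>M)"
  define d where "d = (\<integral>\<omega>. (norm (xs k \<omega> - xstar))\<^sup>2 \<partial>M)"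
  define e where "e = (\<integral>\<omega>. (norm (vs k \<omega> - xstar))\<^sup>2 \<partial>M)"
  note hbi = int'[THEN has_bochner_integral_integrable] int[THEN has_bochner_integral_integrable]
  note hbi = hbi[folded a_def b_def c_def d_def e_def]
  have "has_bochner_integral M (\<lambda>\<omega>. m * (P (xs (Suc k) \<omega>) - P xstar)
        + (\<eta> + m * \<mu>) / 2 * (norm (vs (Suc k) \<omega> - xstar))\<^sup>2
        - m * (1 / 2 * (P (xs k \<omega>) - P xstar) - \<mu> / 4 * (norm (xs k \<omega> - xstar))\<^sup>2))
      (m * a + (\<eta> + m * \<mu>) / 2 * b - m * (1 / 2 * c - \<mu> / 4 * d))" (is "has_bochner_integral M ?l _")
    by (intro has_bochner_integral_add has_bochner_integral_diff has_bochner_integral_mult_right hbi)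
  moreover have "?l \<omega> \<le> \<Psi> (?len (Suc k)) (\<lambda>j. ?X j \<omega>)" for \<omega>
    using lower[of "\<lambda>j. ?X j \<omega>"] by (simp add: xs vs stage_cost_def x0_def)
  ultimately have "m * a + (\<eta> + m * \<mu>) / 2 * b - m * (1 / 2 * c - \<mu> / 4 * d)
      \<le> path_mean q {1..n} J' (\<Psi> (?len (Suc k)))"
    using \<Psi>' by (auto intro: has_bochner_integral_mono)
  also note \<Psi>_mean
  also have "path_mean q {1..n} J (\<Psi> 0) \<le> \<eta> / 2 * ((1 - \<alpha>) * e + \<alpha> * d)"
  proof -
    have "has_bochner_integral M (\<lambda>\<omega>. \<eta> / 2 * ((1 - \<alpha>) * (norm (vs k \<omega> - xstar))\<^sup>2
          + \<alpha> * (norm (xs k \<omega> - xstar))\<^sup>2)) (\<eta> / 2 * ((1 - \<alpha>) * e + \<alpha> * d))"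
      by (intro has_bochner_integral_add has_bochner_integral_mult_right hbi)
    moreover have "\<Psi> 0 (\<lambda>j. ?X j \<omega>) \<le> \<eta> / 2 * ((1 - \<alpha>) * (norm (vs k \<omega> - xstar))\<^sup>2
          + \<alpha> * (norm (xs k \<omega> - xstar))\<^sup>2)" for \<omega>
      using upper[of "\<lambda>j. ?X j \<omega>"] by (simp add: xs vs)
    ultimately show ?thesis
      using \<Psi>0 by (auto intro: has_bochner_integral_mono)
  qed
  finally have "m * a + (\<eta> + m * \<mu>) / 2 * b
      \<le> m * (1 / 2 * c - \<mu> / 4 * d) + \<eta> / 2 * ((1 - \<alpha>) * e + \<alpha> * d)"
    by linarith
  then have "(m * a + (\<eta> + m * \<mu>) / 2 * b) / m
      \<le> (m * (1 / 2 * c - \<mu> / 4 * d) + \<eta> / 2 * ((1 - \<alpha>) * e + \<alpha> * d)) / m"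
    using m by (intro divide_right_mono) auto
  also have "(m * a + (\<eta> + m * \<mu>) / 2 * b) / m = a + (\<eta> + m * \<mu>) / (2 * m) * b"
    using m by (simp add: field_simps)
  also have "(m * (1 / 2 * c - \<mu> / 4 * d) + \<eta> / 2 * ((1 - \<alpha>) * e + \<alpha> * d)) / m
      = 1 / 2 * c + (\<alpha> * \<eta> / (2 * m) - \<mu> / 4) * d + (1 - \<alpha>) * \<eta> / (2 * m) * e"
    using m by (simp add: field_simps)
  finally have "a + (\<eta> + m * \<mu>) / (2 * m) * b
      \<le> 1 / 2 * c + (\<alpha> * \<eta> / (2 * m) - \<mu> / 4) * d + (1 - \<alpha>) * \<eta> / (2 * m) * e" .
  then show ?thesis
    unfolding a_def b_def c_def d_def e_def .
qed

end

theorem theorem5p1: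
  fixes n :: nat
    and f :: "nat \<Rightarrow> real ^ 'd \<Rightarrow> real"
    and L :: "nat \<Rightarrow> real"
    and R :: "real ^ 'd \<Rightarrow> real"
    and \<mu> \<eta> \<alpha> :: real
    and m1 s :: nat
    and xt0 xstar :: "real ^ 'd"
    and M :: "'w measure"
    and I :: "nat \<Rightarrow> nat \<Rightarrow> 'w \<Rightarrow> nat"
  assumes "n \<ge> 1"
    and "\<And>i. i \<in> {1..n} \<Longrightarrow> convex_on UNIV (f i)"
    and "\<And>i x. i \<in> {1..n} \<Longrightarrow> f i differentiable (at x)"
    and "\<And>i. i \<in> {1..n} \<Longrightarrow> L i > 0"
    and "\<And>i. i \<in> {1..n} \<Longrightarrow> (L i)-lipschitz_on UNIV (grad (f i))"
    and "\<mu> \<ge> 0"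
    and "strongly_convex \<mu> R"
    and "is_arg_min (objective n f R) (\<lambda>_. True) xstar"
    and "\<eta> = 4 * Lbar n L"
    and "m1 \<ge> 1"
    and "0 \<le> \<alpha>" and "\<alpha> \<le> 1"
    and "prob_space M"
    and "svrda_draws M n L (stage_length \<mu> m1) I"
    and "s \<ge> 1"
  shows
    "(\<integral>\<omega>. objective n f R (svrda_x n f L R \<mu> \<eta> \<alpha> m1 xt0 I s \<omega>) - objective n f R xstar \<partial>M)
       + (\<eta> + real (stage_length \<mu> m1 s) * \<mu>) / (2 * real (stage_length \<mu> m1 s))
         * (\<integral>\<omega>. (norm (svrda_v n f L R \<mu> \<eta> \<alpha> m1 xt0 I s \<omega> - xstar))\<^sup>2 \<partial>M)
     \<le> 1 / 2 * (\<integral>\<omega>. objective n f R (svrda_x n f L R \<mu> \<eta> \<alpha> m1 xt0 I (s - 1) \<omega>)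
                       - objective n f R xstar \<partial>M)
       + (\<alpha> * \<eta> / (2 * real (stage_length \<mu> m1 s)) - \<mu> / 4)
         * (\<integral>\<omega>. (norm (svrda_x n f L R \<mu> \<eta> \<alpha> m1 xt0 I (s - 1) \<omega> - xstar))\<^sup>2 \<partial>M)
       + (1 - \<alpha>) * \<eta> / (2 * real (stage_length \<mu> m1 s))
         * (\<integral>\<omega>. (norm (svrda_v n f L R \<mu> \<eta> \<alpha> m1 xt0 I (s - 1) \<omega> - xstar))\<^sup>2 \<partial>M)"
proof -
  interpret composite_problem n f L R \<mu> xstar
    by unfold_locales (use assms in auto)
  obtain k where "s = Suc k"
    using \<open>s \<ge> 1\<close> by (cases s) auto
  then show ?thesis
    using svrda_stage_recursion[OF \<open>m1 \<ge> 1\<close> \<open>0 \<le> \<alpha>\<close> \<open>\<alpha> \<le> 1\<close> \<open>prob_space M\<close>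
        \<open>svrda_draws M n L (stage_length \<mu> m1) I\<close>, where k = k and ?xt0.0 = xt0] \<open>\<eta> = 4 * Lbar n L\<close>
    by simp
qed

end
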